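(* Let $\alpha\in(0,1)$, let $H\in C(\mathbb{T}^N\times\mathbb{R}^N)$ be coercive, i.e. $\lim_{|p|\to+\infty}\inf_{x\in\mathbb{T}^N}H(x,p)=+\infty$, and let $g:\mathbb{T}^N\to\mathbb{R}$ be Lipschitz continuous. Assume that at least one of the following two conditions holds: (A) there is $c_H>0$ such that $|H(x,p)-H(y,p)|\le c_H(1+|p|)|x-y|$ for all $x,y\in\mathbb{T}^N$, $p\in\mathbb{R}^N$; (B) there are $m>1$, $A>0$, $c_H>1$ such that for all $\mu\in(0,1)$, $x,y\in\mathbb{T}^N$, $p\in\mathbb{R}^N$, $$\mu H(x,\mu^{-1}p)-H(x,p)\ge(1-\mu)\big(c_H^{-1}|p|^m-A\big),\qquad |H(x,p)-H(y,p)|\le c_H(1+|p|^m)|x-y|.$$ Let $u:\mathbb{T}^N\times[0,+\infty)\to\mathbb{R}$ be a bounded, continuous viscosity solution of $$\partial_t^\alpha u+H(x,Du)=0\ \text{ in }\mathbb{T}^N\times(0,+\infty),\qquad u(\cdot,0)=g\ \text{ in }\mathbb{T}^N .$$ (i) There exists a modulus of continuity $\omega\in C([0,+\infty))$ (nonnegative, nondecreasing, $\omega(0)=0$), depending only on the data ($\alpha,N,H,g$) and $\|u\|_\infty$ and not on $t$, such that $$|u(x,t)-u(y,t)|\le\omega(|x-y|)\qquad\text{for all }x,y\in\mathbb{T}^N,\ t\ge0 .$$ (ii) If, in addition, there exist $m\ge1$ and $C_0>0$ such that $H(x,p)\ge C_0^{-1}|p|^m-C_0$ for all $x\in\mathbb{T}^N$,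 $p\in\mathbb{R}^N$, then for each $\beta\in(0,1)$ there exists a constant $C>0$, depending only on $\beta$, the data and $\|u\|_\infty$ and not on $t$, such that $$|u(x,t)-u(y,t)|\le C|x-y|^\beta\qquad\text{for all }x,y\in\mathbb{T}^N,\ t\ge0 .$$
   Context: $\mathbb{T}^N=\mathbb{R}^N/\mathbb{Z}^N$ is the flat torus, $|x-y|$ for $x,y\in\mathbb{T}^N$ is the periodic (quotient) distance. $Du$ denotes the gradient in $x$. Caputo derivative of order $\alpha\in(0,1)$ (normalizing constant taken equal to 1): a function $\phi$ on $[0,+\infty)$ is extended to $s<0$ by $\phi(s)=\phi(0)$ and, when the integral exists, $$\partial_t^\alpha\phi(t)=\int_{-\infty}^t\frac{\phi(t)-\phi(s)}{|t-s|^{1+\alpha}}\,ds,\qquad t>0.$$ For $a<b\le t$ set $\partial_t^\alpha[a]\phi(t)=\int_{-\infty}^a\frac{\phi(t)-\phi(s)}{|t-s|^{1+\alpha}}ds$ and $\partial_t^\alpha[a,b]\phi(t)=\int_a^b\frac{\phi(t)-\phi(s)}{|t-s|^{1+\alpha}}ds$. Viscosity solutions: let $u$ be continuous on $\mathbb{T}^N\times[0,+\infty)$, extended by $u(x,s)=u(x,0)$ for $s<0$. $u$ is a viscosity subsolution (resp. supersolution) of $\partial_t^\alpha u+H(x,Du)=0$ in $\mathbb{T}^N\times(0,+\infty)$ if for every $(x_0,t_0)$ with $t_0>0$, every $\delta\in(0,t_0)$ and every $C^1$ function $\varphi$ such that $u-\varphi$ has a maximum (resp. minimum) at $(x_0,t_0)$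 over $B_\delta(x_0)\times[t_0-\delta,t_0+\delta]$, one has $$\partial_t^\alpha[t_0-\delta]u(x_0,\cdot)(t_0)+\partial_t^\alpha[t_0-\delta,t_0]\varphi(x_0,\cdot)(t_0)+H(x_0,D\varphi(x_0,t_0))\le0\quad(\text{resp. }\ge0).$$ A viscosity solution is both a sub- and a supersolution. The initial condition is understood pointwise. *)

theory Defs
  imports "HOL-Analysis.Analysis"
begin

text \<open>
  Functions on the flat torus are represented by \<open>\<int>\<^sup>N\<close>-periodic functions on \<open>\<real>\<^sup>N\<close>, with
  \<open>\<real>\<^sup>N\<close> the type \<^typ>\<open>real ^ 'n\<close>; continuity and differentiability on the torus are those
  of the periodic lift. Functions of time are only constrained on the half line on which they are
  meaningful, since their HOL values elsewhere are junk.
\<close>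

definition int_lattice :: "(real ^ 'n) set" where
  "int_lattice = {k. \<forall>i. k $ i \<in> \<int>}"

definition periodic :: "(real ^ 'n \<Rightarrow> 'b) \<Rightarrow> bool" where
  "periodic f \<longleftrightarrow> (\<forall>x. \<forall>k\<in>int_lattice. f (x + k) = f x)"

definition torus_dist :: "real ^ 'n \<Rightarrow> real ^ 'n \<Rightarrow> real" where
  "torus_dist x y = (INF k\<in>int_lattice. norm (x - y + k))"

definition extend_past :: "(real \<Rightarrow> real) \<Rightarrow> real \<Rightarrow> real" where
  "extend_past \<phi> s = (if s < 0 then \<phi> 0 else \<phi> s)"

text \<open>
  The two pieces \<open>\<partial>\<^sub>t\<^sup>\<alpha>[a]\<phi>(t)\<close> and \<open>\<partial>\<^sub>t\<^sup>\<alpha>[a,b]\<phi>(t)\<close> of the Caputo derivative (normalizing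
  constant 1).
\<close>

definition caputo_tail :: "real \<Rightarrow> real \<Rightarrow> (real \<Rightarrow> real) \<Rightarrow> real \<Rightarrow> real" where
  "caputo_tail \<alpha> a \<phi> t =
     set_lebesgue_integral lborel {..a} (\<lambda>s. (\<phi> t - \<phi> s) / \<bar>t - s\<bar> powr (1 + \<alpha>))"

definition caputo_between :: "real \<Rightarrow> real \<Rightarrow> real \<Rightarrow> (real \<Rightarrow> real) \<Rightarrow> real \<Rightarrow> real" where
  "caputo_between \<alpha> a b \<phi> t =
     set_lebesgue_integral lborel {a..b} (\<lambda>s. (\<phi> t - \<phi> s) / \<bar>t - s\<bar> powr (1 + \<alpha>))"

definition C1_on :: "'a::real_normed_vector set \<Rightarrow> ('a \<Rightarrow> real) \<Rightarrow> bool" where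
  "C1_on S f \<longleftrightarrow> (\<exists>f' :: 'a \<Rightarrow> 'a \<Rightarrow>\<^sub>L real.
     (\<forall>z\<in>S. (f has_derivative blinfun_apply (f' z)) (at z)) \<and> continuous_on S f')"

definition grad :: "('a::real_inner \<Rightarrow> real) \<Rightarrow> 'a \<Rightarrow> 'a" where
  "grad f x = (THE p. GDERIV f x :> p)"

lemma grad_eqI:
  assumes "GDERIV f x :> p"
  shows "grad f x = p"
proof -
  have "q = p" if "GDERIV f x :> q" for q
  proof -
    have "(\<lambda>h. inner h q) = (\<lambda>h. inner h p)"
      using that assms has_derivative_unique unfolding gderiv_def by blast
    then have "inner (q - p) q = inner (q - p) p"
      by meson
    then have "inner (q - p) (q - p) = 0"
      by (simp add: inner_diff_right)
    then show ?thesis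
      by simp
  qed
  with assms show ?thesis
    unfolding grad_def by blast
qed

definition test_function :: "(real ^ 'n \<Rightarrow> real \<Rightarrow> real) \<Rightarrow> bool" where
  "test_function \<phi> \<longleftrightarrow>
     (\<forall>t>0. periodic (\<lambda>x. \<phi> x t)) \<and> C1_on (UNIV \<times> {0<..}) (\<lambda>(x, t). \<phi> x t)"

text \<open>
  Left-hand side of the viscosity inequality at \<open>(x\<^sub>0, t\<^sub>0)\<close>. Both integrands are Lebesgue integrable
  for \<open>u\<close> continuous on \<open>\<real>\<^sup>N \<times> [0, \<infinity>)\<close>, \<open>\<phi>\<close> a test function, \<open>0 < \<alpha> < 1\<close> and \<open>0 < \<delta> < t\<^sub>0\<close>.
\<close>

definition visc_lhs :: "real \<Rightarrow> (real ^ 'n \<Rightarrow> real ^ 'n \<Rightarrow> real) \<Rightarrow> (real ^ 'n \<Rightarrow> real \<Rightarrow> real) \<Rightarrow>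
    (real ^ 'n \<Rightarrow> real \<Rightarrow> real) \<Rightarrow> real \<Rightarrow> real ^ 'n \<Rightarrow> real \<Rightarrow> real" where
  "visc_lhs \<alpha> H u \<phi> \<delta> x0 t0 =
     caputo_tail \<alpha> (t0 - \<delta>) (extend_past (u x0)) t0
     + caputo_between \<alpha> (t0 - \<delta>) t0 (\<phi> x0) t0
     + H x0 (grad (\<lambda>x. \<phi> x t0) x0)"

text \<open>
  Since \<open>u\<close> and \<open>\<phi>\<close> are periodic in space, an extremum over the Euclidean ball is the same as an
  extremum over the ball of the torus, which is its image under the projection.
\<close>

definition visc_subsolution ::
    "real \<Rightarrow> (real ^ 'n \<Rightarrow> real ^ 'n \<Rightarrow> real) \<Rightarrow> (real ^ 'n \<Rightarrow> real \<Rightarrow> real) \<Rightarrow> bool" where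
  "visc_subsolution \<alpha> H u \<longleftrightarrow>
     (\<forall>x0 t0 \<delta> \<phi>. 0 < t0 \<and> 0 < \<delta> \<and> \<delta> < t0 \<and> test_function \<phi> \<and>
        (\<forall>x\<in>ball x0 \<delta>. \<forall>t\<in>{t0 - \<delta>..t0 + \<delta>}. u x t - \<phi> x t \<le> u x0 t0 - \<phi> x0 t0)
        \<longrightarrow> visc_lhs \<alpha> H u \<phi> \<delta> x0 t0 \<le> 0)"

definition visc_supersolution ::
    "real \<Rightarrow> (real ^ 'n \<Rightarrow> real ^ 'n \<Rightarrow> real) \<Rightarrow> (real ^ 'n \<Rightarrow> real \<Rightarrow> real) \<Rightarrow> bool" where
  "visc_supersolution \<alpha> H u \<longleftrightarrow>
     (\<forall>x0 t0 \<delta> \<phi>. 0 < t0 \<and> 0 < \<delta> \<and> \<delta> < t0 \<and> test_function \<phi> \<and>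
        (\<forall>x\<in>ball x0 \<delta>. \<forall>t\<in>{t0 - \<delta>..t0 + \<delta>}. u x t - \<phi> x t \<ge> u x0 t0 - \<phi> x0 t0)
        \<longrightarrow> visc_lhs \<alpha> H u \<phi> \<delta> x0 t0 \<ge> 0)"

definition bounded_visc_solution ::
    "real \<Rightarrow> (real ^ 'n \<Rightarrow> real ^ 'n \<Rightarrow> real) \<Rightarrow> (real ^ 'n \<Rightarrow> real) \<Rightarrow>
     (real ^ 'n \<Rightarrow> real \<Rightarrow> real) \<Rightarrow> bool" where
  "bounded_visc_solution \<alpha> H g u \<longleftrightarrow>
     (\<forall>t\<ge>0. periodic (\<lambda>x. u x t)) \<and>
     continuous_on (UNIV \<times> {0..}) (\<lambda>(x, t). u x t) \<and>
     bounded ((\<lambda>(x, t). u x t) ` (UNIV \<times> {0..})) \<and>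
     visc_subsolution \<alpha> H u \<and> visc_supersolution \<alpha> H u \<and>
     (\<forall>x. u x 0 = g x)"

definition sup_norm :: "(real ^ 'n \<Rightarrow> real \<Rightarrow> real) \<Rightarrow> real" where
  "sup_norm u = (SUP (x, t)\<in>UNIV \<times> {0..}. \<bar>u x t\<bar>)"

definition coercive :: "(real ^ 'n \<Rightarrow> real ^ 'n \<Rightarrow> real) \<Rightarrow> bool" where
  "coercive H \<longleftrightarrow> filterlim (\<lambda>p. INF x. H x p) at_top at_infinity"

definition cond_A :: "(real ^ 'n \<Rightarrow> real ^ 'n \<Rightarrow> real) \<Rightarrow> bool" where
  "cond_A H \<longleftrightarrow> (\<exists>c>0. \<forall>x y p. \<bar>H x p - H y p\<bar> \<le> c * (1 + norm p) * torus_dist x y)"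

definition cond_B :: "(real ^ 'n \<Rightarrow> real ^ 'n \<Rightarrow> real) \<Rightarrow> bool" where
  "cond_B H \<longleftrightarrow> (\<exists>m>1. \<exists>A>0. \<exists>c>1. \<forall>\<mu>\<in>{0<..<1}. \<forall>x y p.
     \<mu> * H x (inverse \<mu> *\<^sub>R p) - H x p \<ge> (1 - \<mu>) * (inverse c * norm p powr m - A) \<and>
     \<bar>H x p - H y p\<bar> \<le> c * (1 + norm p powr m) * torus_dist x y)"

definition modulus_of_continuity :: "(real \<Rightarrow> real) \<Rightarrow> bool" where
  "modulus_of_continuity \<omega> \<longleftrightarrow>
     continuous_on {0..} \<omega> \<and> (\<forall>r\<ge>0. 0 \<le> \<omega> r) \<and> mono_on {0..} \<omega> \<and> \<omega> 0 = 0"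

end

theory Submission
  imports Defs
begin

text \<open>
  First, barriers \<open>L sqrt(\<rho>\<^sup>2 + |x - y|\<^sup>2) + C t\<^sup>\<alpha>\<close> give \<open>|u(x,t) - g(x)| \<le> C t\<^sup>\<alpha>\<close>. Next, doubling
  variables in space and time propagates this to \<open>|u(x,t) - u(x,s)| \<le> C |t - s|\<^sup>\<alpha>\<close> uniformly in time: the
  constant history before time 0 makes a small multiple of \<open>t\<^sup>\<alpha>\<close> an admissible penalisation at
  infinity, and (A) or (B) absorbs the difference of the Hamiltonians. Finally, at a maximum of
  \<open>u(x,t) - K |x - y| - (t - s)\<^sup>2 / \<eta>\<^bsup>2 - \<alpha>\<^esup>\<close> the Hoelder bound in time controls the fractional
  derivative by \<open>\<eta>\<^bsup>- \<theta>\<^esup>\<close> for every small \<open>\<theta> > 0\<close>, so coercivity bounds the slope \<open>K\<close>; the error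
  of the time penalisation is of order \<open>\<eta>\<^sup>\<alpha>\<close>, and optimising in \<open>\<eta>\<close> gives both claims.
\<close>

text \<open>The space estimate freezes the point \<open>(y, s)\<close> and tests \<open>u\<close> in
  \<open>(x, t)\<close> only, so it needs the subsolution inequality alone and no comparison of
  Hamiltonians. In exchange the fractional derivative must be bounded below, which is what the
  regularity in time is for. A Hoelder bound with the exact exponent \<alpha> leaves the integrand
  1/r, whose integral diverges logarithmically at both ends. So lags below \<eta> are controlled by
  the smooth penalisation, lags between \<eta> and 1 trade r^\<alpha> for r^(\<alpha> - \<theta>),
  and longer lags use the bound on \<open>u\<close>. The loss \<eta>^(-\<theta>) is why (ii) comes
  with \<beta> < 1: for \<eta>^\<alpha> = |x - y| and \<theta> = \<alpha> (1 - \<beta>), slope times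
  distance is of order |x - y|^\<beta>.

  In the doubling argument the penalisation \<sigma> s^\<alpha> gains \<sigma> s0^\<alpha> times the
  integral of r^(-1-\<alpha>) over r > s0, that is \<sigma>/\<alpha>, however large s0 is. This
  gain, independent of time, pays for all errors and makes the estimate uniform in t.\<close>

section \<open>A smooth periodic squared distance\<close>

text \<open>
  The torus distance is not differentiable at the cut locus, so test functions use
  \<open>sinsq (x - y)\<close>, which is smooth, periodic and comparable to its square.
\<close>

definition sinsq :: "real ^ 'n \<Rightarrow> real" where
  "sinsq z = (\<Sum>i\<in>UNIV. (sin (pi * z $ i))\<^sup>2)"

definition sinsq_grad :: "real ^ 'n \<Rightarrow> real ^ 'n" where
  "sinsq_grad z = (\<chi> i. 2 * pi * sin (pi * z $ i) * cos (pi * z $ i))"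

lemma sinsq_nonneg [simp]: "0 \<le> sinsq z"
  by (simp add: sinsq_def sum_nonneg)

lemma sinsq_0 [simp]: "sinsq 0 = 0"
  by (simp add: sinsq_def)

lemma sinsq_minus [simp]: "sinsq (- z) = sinsq z"
  by (simp add: sinsq_def)

lemma sinsq_commute: "sinsq (x - y) = sinsq (y - x)"
  using sinsq_minus[of "x - y"] by simp

lemma sinsq_grad_minus [simp]: "sinsq_grad (- z) = - sinsq_grad z"
  by (simp add: sinsq_grad_def vec_eq_iff)

lemma sinsq_add_lattice:
  assumes "k \<in> int_lattice"
  shows "sinsq (z + k) = sinsq z"
proof -
  have "(sin (pi * (z + k) $ i))\<^sup>2 = (sin (pi * z $ i))\<^sup>2" for i
  proof -
    obtain j where "k $ i = of_int j"
      using assms by (auto simp: int_lattice_def Ints_def)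
    moreover have "(cos (pi * of_int j))\<^sup>2 = 1" "sin (pi * of_int j) = 0"
      using sin_cos_squared_add[of "pi * of_int j"]
      by (simp_all add: mult.commute sin_int_times_real)
    ultimately show ?thesis
      by (simp add: distrib_left sin_add power_mult_distrib)
  qed
  then show ?thesis
    by (simp add: sinsq_def)
qed

lemma int_lattice_uminus: "k \<in> int_lattice \<Longrightarrow> - k \<in> int_lattice"
  by (simp add: int_lattice_def)

lemma ex_lattice_half: "\<exists>k\<in>int_lattice. \<forall>i. \<bar>(z + k) $ i\<bar> \<le> 1 / 2"
proof
  show "\<forall>i. \<bar>(z + (\<chi> i. - of_int (round (z $ i)))) $ i\<bar> \<le> 1 / 2"
    using of_int_round_abs_le[of "z $ _"] by (auto simp: abs_minus_commute)
qed (simp add: int_lattice_def)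

lemma ex_lattice_cbox: "\<exists>k\<in>int_lattice. z + k \<in> cbox 0 (\<chi> i. 1)"
proof
  show "z + (\<chi> i. - of_int \<lfloor>z $ i\<rfloor>) \<in> cbox 0 (\<chi> i. 1)"
    by (auto simp: mem_box_cart) linarith
qed (simp add: int_lattice_def)

lemma continuous_on_sinsq [continuous_intros]:
  fixes f :: "'a::t2_space \<Rightarrow> real ^ 'n"
  shows "continuous_on S f \<Longrightarrow> continuous_on S (\<lambda>x. sinsq (f x))"
  unfolding sinsq_def by (intro continuous_intros)

lemma continuous_on_sinsq_grad [continuous_intros]:
  fixes f :: "'a::t2_space \<Rightarrow> real ^ 'n"
  shows "continuous_on S f \<Longrightarrow> continuous_on S (\<lambda>x. sinsq_grad (f x))"
  unfolding sinsq_grad_def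
  by (intro continuous_intros)

text \<open>With x = pi |w| \<le> 1.6, Taylor's bound sin x \<ge> x - x^3/6 and x^2 \<le> 3 give sin
  x \<ge> x/2 \<ge> |w|. This is the half of the comparison that makes \<open>sinsq\<close> dominate
  the squared torus distance.\<close>

lemma abs_le_abs_sin_pi:
  assumes "\<bar>w\<bar> \<le> 1 / 2"
  shows "\<bar>w\<bar> \<le> \<bar>sin (pi * w)\<bar>"
proof -
  define x where "x = pi * \<bar>w\<bar>"
  have x: "0 \<le> x" "x \<le> 1.6"
    using assms pi_approx mult_mono[of pi "3.2" "\<bar>w\<bar>" "1/2"] by (auto simp: x_def)
  have "\<bar>sin x - (\<Sum>m<3. sin_coeff m * x ^ m)\<bar> \<le> inverse (fact 3) * \<bar>x\<bar> ^ 3"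
    by (rule Maclaurin_sin_bound)
  then have "\<bar>sin x - x\<bar> \<le> x ^ 3 / 6"
    using x by (simp add: eval_nat_numeral sin_coeff_def)
  then have "sin x \<ge> x - x ^ 3 / 6"
    by linarith
  moreover have "x * x \<le> 1.6 * 1.6"
    using x by (intro mult_mono) auto
  then have "x * (x * x) \<le> x * 3"
    using x by (intro mult_left_mono) auto
  then have "x ^ 3 / 6 \<le> x / 2"
    by (simp add: eval_nat_numeral)
  ultimately have "sin x \<ge> x / 2"
    by linarith
  moreover have "x / 2 \<ge> \<bar>w\<bar>"
    using pi_ge_two mult_right_mono[of 2 pi "\<bar>w\<bar>"] by (simp add: x_def)
  moreover have "\<bar>sin (pi * w)\<bar> = \<bar>sin x\<bar>"
    by (cases "w \<ge> 0") (auto simp: x_def)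
  ultimately show ?thesis
    by linarith
qed

lemma torus_dist_bdd: "bdd_below ((\<lambda>k. norm (x - y + k)) ` int_lattice)"
  by (rule bdd_belowI[of _ 0]) auto

lemma torus_dist_le: "torus_dist x y \<le> sqrt (sinsq (x - y))"
proof -
  obtain k where k: "k \<in> int_lattice" "\<forall>i. \<bar>(x - y + k) $ i\<bar> \<le> 1 / 2"
    using ex_lattice_half by blast
  have "torus_dist x y \<le> norm (x - y + k)"
    unfolding torus_dist_def by (rule cINF_lower[OF torus_dist_bdd k(1)])
  also have "\<dots> = sqrt (\<Sum>i\<in>UNIV. ((x - y + k) $ i)\<^sup>2)"
    by (simp add: norm_vec_def L2_set_def)
  also have "\<dots> \<le> sqrt (sinsq (x - y + k))"
    unfolding sinsq_def
    by (intro real_sqrt_le_mono sum_mono)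
      (use abs_le_abs_sin_pi k(2) in \<open>simp add: abs_le_square_iff\<close>)
  finally show ?thesis
    using sinsq_add_lattice[OF k(1)] by simp
qed

lemma sqrt_sinsq_le:
  fixes x y :: "real ^ 'n"
  shows "sqrt (sinsq (x - y)) \<le> pi * torus_dist x y"
proof -
  have ne: "int_lattice \<noteq> ({} :: (real ^ 'n) set)"
    using ex_lattice_half by blast
  have "sqrt (sinsq (x - y)) / pi \<le> norm (x - y + k)" if "k \<in> int_lattice" for k :: "real ^ 'n"
  proof -
    have "sqrt (sinsq (x - y)) = sqrt (sinsq (x - y + k))"
      using sinsq_add_lattice[OF that] by simp
    also have "\<dots> \<le> sqrt (\<Sum>i\<in>UNIV. (pi * (x - y + k) $ i)\<^sup>2)"
      unfolding sinsq_def
      by (intro real_sqrt_le_mono sum_mono)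
        (simp add: abs_le_square_iff[symmetric] abs_sin_x_le_abs_x del: abs_mult)
    also have "\<dots> = pi * norm (x - y + k)"
      by (simp add: norm_vec_def L2_set_def power_mult_distrib sum_distrib_left[symmetric]
          real_sqrt_mult)
    finally show ?thesis
      by (simp add: field_simps)
  qed
  then have "sqrt (sinsq (x - y)) / pi \<le> torus_dist x y"
    unfolding torus_dist_def by (intro cINF_greatest ne) auto
  then show ?thesis
    by (simp add: field_simps)
qed

lemma torus_dist_nonneg: "0 \<le> torus_dist x y"
proof -
  have "0 \<le> pi * torus_dist x y"
    using sqrt_sinsq_le[of x y] real_sqrt_ge_zero[OF sinsq_nonneg[of "x - y"]] by linarith
  then show ?thesis
    using pi_gt_zero by (simp add: zero_le_mult_iff)
qed

lemma periodicD: "periodic f \<Longrightarrow> k \<in> int_lattice \<Longrightarrow> f (x + k) = f x"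
  by (simp add: periodic_def)

lemma sinsq_eq_0_imp_lattice:
  assumes "sinsq z = 0"
  shows "z \<in> int_lattice"
proof -
  have "z $ i \<in> \<int>" for i
  proof -
    have "sin (pi * z $ i) = 0"
      using assms by (auto simp: sinsq_def sum_nonneg_eq_0_iff)
    then obtain j :: int where "pi * z $ i = of_int j * pi"
      by (auto simp: sin_zero_iff_int2)
    then show ?thesis
      by simp
  qed
  then show ?thesis
    by (simp add: int_lattice_def)
qed

lemma periodic_eq_if_sinsq_0:
  assumes "periodic f" "sinsq (x - y) = 0"
  shows "f x = f y"
  using periodicD[OF assms(1) sinsq_eq_0_imp_lattice[OF assms(2)], of y] by simp

lemma norm_sinsq_grad: "norm (sinsq_grad z) = sqrt (\<Sum>i\<in>UNIV. 4 * pi\<^sup>2 * (sin (pi * z $ i))\<^sup>2 * (cos (pi * z $ i))\<^sup>2)"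
  by (simp add: norm_vec_def L2_set_def sinsq_grad_def power_mult_distrib)

lemma norm_sinsq_grad_le: "norm (sinsq_grad z) \<le> 2 * pi * sqrt (sinsq z)"
proof -
  have "norm (sinsq_grad z) \<le> sqrt (\<Sum>i\<in>UNIV. 4 * pi\<^sup>2 * (sin (pi * z $ i))\<^sup>2 * 1)"
    unfolding norm_sinsq_grad
    by (intro real_sqrt_le_mono sum_mono mult_left_mono) (auto simp: abs_square_le_1)
  also have "\<dots> = 2 * pi * sqrt (sinsq z)"
    by (simp add: sinsq_def sum_distrib_left[symmetric] real_sqrt_mult)
  finally show ?thesis .
qed

text \<open>The gradient also vanishes where coordinates are half-integers, far from the lattice. A
  small \<open>sinsq\<close> excludes this, since then every squared cosine is at least 1/2.\<close>

lemma norm_sinsq_grad_ge: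
  assumes "sinsq z \<le> 1 / 2"
  shows "2 * sqrt (sinsq z) \<le> norm (sinsq_grad z)"
proof -
  have c: "1 / 2 \<le> (cos (pi * z $ i))\<^sup>2" for i
  proof -
    have "(sin (pi * z $ i))\<^sup>2 \<le> sinsq z"
      unfolding sinsq_def by (rule member_le_sum) auto
    then show ?thesis
      using assms sin_cos_squared_add[of "pi * z $ i"] by linarith
  qed
  have "2 * 2 \<le> pi * pi"
    using pi_ge_two by (intro mult_mono) auto
  then have p: "2 * 2 \<le> pi\<^sup>2"
    by (simp add: power2_eq_square)
  have "2 * sqrt (sinsq z) = sqrt (\<Sum>i\<in>UNIV. 4 * (sin (pi * z $ i))\<^sup>2)"
    by (simp add: sinsq_def sum_distrib_left[symmetric] real_sqrt_mult)
  also have "\<dots> \<le> sqrt (\<Sum>i\<in>UNIV. 4 * pi\<^sup>2 * (sin (pi * z $ i))\<^sup>2 * (cos (pi * z $ i))\<^sup>2)"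
  proof (intro real_sqrt_le_mono sum_mono)
    fix i
    have "1 \<le> pi\<^sup>2 * (cos (pi * z $ i))\<^sup>2"
      using mult_mono[OF p c[of i]] by simp
    then have "4 * (sin (pi * z $ i))\<^sup>2 * 1
        \<le> 4 * (sin (pi * z $ i))\<^sup>2 * (pi\<^sup>2 * (cos (pi * z $ i))\<^sup>2)"
      by (intro mult_left_mono) auto
    then show "4 * (sin (pi * z $ i))\<^sup>2 \<le> 4 * pi\<^sup>2 * (sin (pi * z $ i))\<^sup>2 * (cos (pi * z $ i))\<^sup>2"
      by (simp add: mult_ac)
  qed
  finally show ?thesis
    by (simp add: norm_sinsq_grad)
qed

lemma has_derivative_sinsq:
  fixes z :: "real ^ 'n"
  shows "(sinsq has_derivative (\<lambda>h. inner (sinsq_grad z) h)) (at z)"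
proof -
  have "((\<lambda>z::real^'n. \<Sum>i\<in>UNIV. (sin (pi * z $ i))\<^sup>2) has_derivative
     (\<lambda>h. \<Sum>i\<in>UNIV. of_nat 2 * (pi * h $ i * cos (pi * z $ i)) * sin (pi * z $ i) ^ (2 - 1))) (at z)"
    by (intro has_derivative_sum has_derivative_power
        DERIV_compose_FDERIV[OF DERIV_sin]
        has_derivative_mult_right
        bounded_linear.has_derivative[OF bounded_linear_vec_nth] has_derivative_ident)
  then show ?thesis
    unfolding sinsq_def[abs_def, symmetric]
    by (simp add: inner_vec_def sinsq_grad_def mult_ac)
qed

lemma has_derivative_sinsq_comp:
  assumes "(f has_derivative f') (at x)"
  shows "((\<lambda>x. sinsq (f x)) has_derivative (\<lambda>h. inner (sinsq_grad (f x)) (f' h))) (at x)"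
  using has_derivative_compose[OF assms has_derivative_sinsq] .

text \<open>The time part need only be C^1 for positive times, which admits the barrier t^\<alpha>
  in spite of its infinite slope at 0.\<close>

lemma test_function_sinsq:
  fixes y :: "real ^ 'n"
  assumes f: "\<And>t. 0 < t \<Longrightarrow> (f has_real_derivative f' t) (at t)"
    and f': "continuous_on {0<..} f'"
  shows "test_function (\<lambda>x t. a * sinsq (x - y) + f t)"
proof -
  define G where "G = (\<lambda>z::(real^'n) \<times> real. (a *\<^sub>R sinsq_grad (fst z - y), f' (snd z)))"
  have "periodic (\<lambda>x. a * sinsq (x - y) + f t)" for t
    unfolding periodic_def
    using sinsq_add_lattice[of _ "_ - y"] by (metis diff_add_eq)
  moreover have "((\<lambda>(x, t). a * sinsq (x - y) + f t) has_derivative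
      blinfun_apply (blinfun_inner_right (G z))) (at z)" if z: "z \<in> UNIV \<times> {0<..}" for z
  proof -
    have "((\<lambda>w. f (snd w)) has_derivative (\<lambda>h. f' (snd z) * snd h)) (at z)"
      using has_derivative_compose[OF has_derivative_snd[OF has_derivative_ident]
          f[unfolded has_field_derivative_def], of z UNIV] z by auto
    then have "((\<lambda>w. a * sinsq (fst w - y) + f (snd w)) has_derivative
        (\<lambda>h. a * inner (sinsq_grad (fst z - y)) (fst h) + f' (snd z) * snd h)) (at z)"
      by (intro has_derivative_add has_derivative_mult_right has_derivative_sinsq_comp)
        (auto intro!: has_derivative_eq_rhs[OF has_derivative_diff[OF
            has_derivative_fst[OF has_derivative_ident] has_derivative_const]])
    moreover have "(\<lambda>h. a * inner (sinsq_grad (fst z - y)) (fst h) + f' (snd z) * snd h) =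
        blinfun_apply (blinfun_inner_right (G z))"
      by (simp add: G_def fun_eq_iff)
    ultimately show ?thesis
      by (simp add: case_prod_beta')
  qed
  moreover have "continuous_on (UNIV \<times> {0<..}) (\<lambda>z. blinfun_inner_right (G z))"
    unfolding G_def
    by (intro bounded_linear.continuous_on[OF bounded_linear_blinfun_inner_right] continuous_intros
        continuous_on_compose2[OF f']) auto
  ultimately show ?thesis
    unfolding test_function_def C1_on_def
    by (intro conjI allI impI exI[of _ "\<lambda>z. blinfun_inner_right (G z)"] ballI) simp_all
qed

lemma grad_sinsq: "grad (\<lambda>x. a * sinsq (x - y) + c) x = a *\<^sub>R sinsq_grad (x - y)"
proof (rule grad_eqI)
  have "((\<lambda>x. a * sinsq (x - y) + c) has_derivative (\<lambda>h. a * inner (sinsq_grad (x - y)) h)) (at x)"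
    using has_derivative_add[OF has_derivative_mult_right[OF has_derivative_sinsq_comp[OF
            has_derivative_diff[OF has_derivative_ident has_derivative_const]]] has_derivative_const]
    by simp
  then show "GDERIV (\<lambda>x. a * sinsq (x - y) + c) x :> a *\<^sub>R sinsq_grad (x - y)"
    by (simp add: gderiv_def inner_commute)
qed

section \<open>The fractional derivative and separated test functions\<close>

text \<open>The variable is the lag r = t - s, so the domain of integration does not move with t and
  tails based at two different times can be added under one integral.\<close>

definition frac_tail :: "real \<Rightarrow> real \<Rightarrow> (real \<Rightarrow> real) \<Rightarrow> real \<Rightarrow> real" where
  "frac_tail \<alpha> \<delta> w t = (\<integral>r. indicator {\<delta>..} r * ((w t - w (t - r)) / r powr (1 + \<alpha>)) \<partial>lborel)"

definition frac_near :: "real \<Rightarrow> real \<Rightarrow> (real \<Rightarrow> real) \<Rightarrow> real \<Rightarrow> real" where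
  "frac_near \<alpha> \<delta> f t = (\<integral>r. indicator {0..\<delta>} r * ((f t - f (t - r)) / r powr (1 + \<alpha>)) \<partial>lborel)"

lemma caputo_tail_eq:
  assumes "0 < \<delta>"
  shows "caputo_tail \<alpha> (t - \<delta>) w t = frac_tail \<alpha> \<delta> w t"
proof -
  have "caputo_tail \<alpha> (t - \<delta>) w t = (\<integral>r. indicator {..t - \<delta>} (t + - 1 * r) *\<^sub>R
      ((w t - w (t + - 1 * r)) / \<bar>t - (t + - 1 * r)\<bar> powr (1 + \<alpha>)) \<partial>lborel)"
    unfolding caputo_tail_def set_lebesgue_integral_def
    by (subst lborel_integral_real_affine[where c = "- 1" and t = t]) simp_all
  also have "\<dots> = frac_tail \<alpha> \<delta> w t"
    unfolding frac_tail_def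
    by (rule Bochner_Integration.integral_cong) (use assms in \<open>auto simp: indicator_def\<close>)
  finally show ?thesis .
qed

lemma caputo_between_eq: "caputo_between \<alpha> (t - \<delta>) t f t = frac_near \<alpha> \<delta> f t"
proof -
  have "caputo_between \<alpha> (t - \<delta>) t f t = (\<integral>r. indicator {t - \<delta>..t} (t + - 1 * r) *\<^sub>R
      ((f t - f (t + - 1 * r)) / \<bar>t - (t + - 1 * r)\<bar> powr (1 + \<alpha>)) \<partial>lborel)"
    unfolding caputo_between_def set_lebesgue_integral_def
    by (subst lborel_integral_real_affine[where c = "- 1" and t = t]) simp_all
  also have "\<dots> = frac_near \<alpha> \<delta> f t"
    unfolding frac_near_def
    by (rule Bochner_Integration.integral_cong) (auto simp: indicator_def)
  finally show ?thesis .
qed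

lemma extend_past_eq: "extend_past \<phi> = (\<lambda>s. \<phi> (max s 0))"
  by (auto simp: extend_past_def fun_eq_iff max_def)

text \<open>For \<theta> = \<alpha>, multiplying by \<open>a powr \<alpha>\<close> gives 1/\<alpha>
  for every \<open>a\<close>: the gain from the constant history does not fade with time.\<close>

lemma tail_kernel:
  fixes a \<theta> :: real
  assumes "0 < a" "0 < \<theta>"
  shows "has_bochner_integral lborel (\<lambda>r. indicator {a..} r * (1 / r powr (1 + \<theta>))) (a powr - \<theta> / \<theta>)"
proof (rule has_bochner_integral_nn_integral)
  have "((\<lambda>r. r powr (- (1 + \<theta>))) has_integral (a powr - \<theta> / \<theta>)) {a..}"
    using has_integral_powr_to_inf[of "- (1 + \<theta>)" a] assms by simp
  then have "((\<lambda>r. 1 / r powr (1 + \<theta>)) has_integral (a powr - \<theta> / \<theta>)) {a..}"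
    by (simp only: powr_minus_divide)
  then show "(\<integral>\<^sup>+ r. ennreal (indicator {a..} r * (1 / r powr (1 + \<theta>))) \<partial>lborel) = ennreal (a powr - \<theta> / \<theta>)"
    by (intro nn_integral_has_integral_lebesgue) auto
qed (use assms in \<open>auto simp: indicator_def\<close>)

lemma near_kernel:
  fixes \<alpha> \<delta> :: real
  assumes "0 \<le> \<delta>" "\<alpha> < 1"
  shows "has_bochner_integral lborel (\<lambda>r. indicator {0..\<delta>} r * r powr - \<alpha>) (\<delta> powr (1 - \<alpha>) / (1 - \<alpha>))"
proof (rule has_bochner_integral_nn_integral)
  have "((\<lambda>r. r powr - \<alpha>) has_integral (\<delta> powr (1 - \<alpha>) / (1 - \<alpha>))) {0..\<delta>}"
    using has_integral_powr_from_0[of "- \<alpha>" \<delta>] assms by simp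
  then show "(\<integral>\<^sup>+ r. ennreal (indicator {0..\<delta>} r * r powr - \<alpha>) \<partial>lborel) = ennreal (\<delta> powr (1 - \<alpha>) / (1 - \<alpha>))"
    by (intro nn_integral_has_integral_lebesgue) auto
qed (use assms in \<open>auto simp: indicator_def\<close>)

text \<open>The sign condition on \<open>g\<close> covers a nonintegrable \<open>f\<close>, whose integral has the junk value 0.\<close>

lemma integral_ge_nonpos:
  fixes f g :: "'a \<Rightarrow> real"
  assumes "integrable M g" "\<And>x. g x \<le> 0" "\<And>x. g x \<le> f x"
  shows "integral\<^sup>L M g \<le> integral\<^sup>L M f"
proof (cases "integrable M f")
  case True
  then show ?thesis
    using assms by (intro integral_mono) auto
next
  case False
  have "integral\<^sup>L M g \<le> integral\<^sup>L M (\<lambda>x. 0)"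
    using assms by (intro integral_mono) auto
  with False show ?thesis
    by (simp add: not_integrable_integral_eq)
qed

text \<open>The minorant - K r^(-\<alpha>) is integrable at 0 and nonpositive, so
  \<open>integral_ge_nonpos\<close> applies without integrability of the integrand of
  \<open>f\<close>.\<close>

lemma frac_near_ge:
  assumes "\<alpha> < 1" "0 \<le> \<delta>" "0 \<le> K"
    and f: "\<And>r. 0 < r \<Longrightarrow> r \<le> \<delta> \<Longrightarrow> - K * r \<le> f t - f (t - r)"
  shows "- K * (\<delta> powr (1 - \<alpha>) / (1 - \<alpha>)) \<le> frac_near \<alpha> \<delta> f t"
proof -
  note k = near_kernel[OF assms(2,1)]
  let ?g = "\<lambda>r. - K * (indicator {0..\<delta>} r * r powr - \<alpha>)"
  have "- K * (\<delta> powr (1 - \<alpha>) / (1 - \<alpha>)) = integral\<^sup>L lborel ?g"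
    using has_bochner_integral_integral_eq[OF k] by simp
  also have "\<dots> \<le> frac_near \<alpha> \<delta> f t"
    unfolding frac_near_def
  proof (rule integral_ge_nonpos)
    show "integrable lborel ?g"
      using integrable.intros[OF k] by (rule integrable_mult_right)
    show "?g r \<le> 0" for r
      using assms by (simp add: indicator_def)
    show "?g r \<le> indicator {0..\<delta>} r * ((f t - f (t - r)) / r powr (1 + \<alpha>))" for r
    proof (cases "0 < r \<and> r \<le> \<delta>")
      case True
      then have "r powr - \<alpha> = r / r powr (1 + \<alpha>)"
        by (simp add: powr_add powr_minus_divide)
      then show ?thesis
        using True divide_right_mono[OF f[of r], of "r powr (1 + \<alpha>)"] by simp
    next
      case False
      then show ?thesis
        by (auto simp: indicator_def)
    qed
  qed
  finally show ?thesis .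
qed

lemma frac_tail_integrable:
  fixes w :: "real \<Rightarrow> real"
  assumes "0 < \<alpha>" "0 < \<delta>" "continuous_on UNIV w" "\<And>s. \<bar>w s\<bar> \<le> R"
  shows "integrable lborel (\<lambda>r. indicator {\<delta>..} r * ((w t - w (t - r)) / r powr (1 + \<alpha>)))"
proof (rule Bochner_Integration.integrable_bound)
  show "integrable lborel (\<lambda>r. (2 * R) * (indicator {\<delta>..} r * (1 / r powr (1 + \<alpha>))))"
    using integrable.intros[OF tail_kernel[OF assms(2,1)]]
    by (rule integrable_mult_right)
  have [measurable]: "w \<in> borel_measurable borel"
    using assms(3) by (rule borel_measurable_continuous_onI)
  show "(\<lambda>r. indicator {\<delta>..} r * ((w t - w (t - r)) / r powr (1 + \<alpha>))) \<in> borel_measurable lborel"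
    by measurable
  have "\<bar>w t - w (t - r)\<bar> \<le> \<bar>2 * R\<bar>" for r
    using assms(4)[of t] assms(4)[of "t - r"] by linarith
  then show "AE r in lborel. norm (indicator {\<delta>..} r * ((w t - w (t - r)) / r powr (1 + \<alpha>)))
      \<le> norm ((2 * R) * (indicator {\<delta>..} r * (1 / r powr (1 + \<alpha>))))"
    by (intro AE_I2) (auto simp: indicator_def intro!: divide_right_mono)
qed

lemma continuous_on_at_point:
  assumes "continuous_on (UNIV \<times> {0..}) (\<lambda>(x, t). u x t)"
  shows "continuous_on UNIV (\<lambda>s. u x (max s (0::real)))"
proof -
  have "continuous_on UNIV (\<lambda>s. (\<lambda>(x, t). u x t) (x, max s (0::real)))"
    by (rule continuous_on_compose2[OF assms]) (auto intro!: continuous_intros)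
  then show ?thesis
    by simp
qed

text \<open>
  The subsolution inequality, in the variable \<open>r = t\<^sub>0 - s\<close>. Test functions of this form suffice because
  a barrier concave in \<open>sinsq (x - y)\<close> can be replaced by its tangent at the maximum point.
\<close>

definition sinsq_subsolution ::
    "real \<Rightarrow> (real ^ 'n \<Rightarrow> real ^ 'n \<Rightarrow> real) \<Rightarrow> (real ^ 'n \<Rightarrow> real \<Rightarrow> real) \<Rightarrow> bool" where
  "sinsq_subsolution \<alpha> H u \<longleftrightarrow>
     (\<forall>x0 t0 \<delta> a y f f'. 0 < \<delta> \<and> \<delta> < t0 \<and>
        (\<forall>t>0. (f has_real_derivative f' t) (at t)) \<and> continuous_on {0<..} f' \<and>
        (\<forall>x. \<forall>t\<ge>0. u x t - a * sinsq (x - y) - f t \<le> u x0 t0 - a * sinsq (x0 - y) - f t0)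
        \<longrightarrow> frac_tail \<alpha> \<delta> (\<lambda>s. u x0 (max s 0)) t0 + frac_near \<alpha> \<delta> f t0
              + H x0 (a *\<^sub>R sinsq_grad (x0 - y)) \<le> 0)"

lemma sinsq_subsolutionD:
  assumes "sinsq_subsolution \<alpha> H u" "0 < \<delta>" "\<delta> < t0"
    and "\<And>t. t > 0 \<Longrightarrow> (f has_real_derivative f' t) (at t)" "continuous_on {0<..} f'"
    and "\<And>x t. t \<ge> 0 \<Longrightarrow>
      u x t - a * sinsq (x - y) - f t \<le> u x0 t0 - a * sinsq (x0 - y) - f t0"
  shows "frac_tail \<alpha> \<delta> (\<lambda>s. u x0 (max s 0)) t0 + frac_near \<alpha> \<delta> f t0
              + H x0 (a *\<^sub>R sinsq_grad (x0 - y)) \<le> 0"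
  using assms unfolding sinsq_subsolution_def by blast

lemma visc_lhs_sinsq:
  assumes "0 < \<delta>"
  shows "visc_lhs \<alpha> H u (\<lambda>x t. a * sinsq (x - y) + f t) \<delta> x0 t0 =
    frac_tail \<alpha> \<delta> (\<lambda>s. u x0 (max s 0)) t0 + frac_near \<alpha> \<delta> f t0 + H x0 (a *\<^sub>R sinsq_grad (x0 - y))"
proof -
  have "frac_near \<alpha> \<delta> (\<lambda>t. a * sinsq (x0 - y) + f t) t0 = frac_near \<alpha> \<delta> f t0"
    by (simp add: frac_near_def)
  then show ?thesis
    using assms
    by (simp add: visc_lhs_def caputo_tail_eq caputo_between_eq extend_past_eq grad_sinsq)
qed

lemma visc_subsolution_imp:
  assumes "visc_subsolution \<alpha> H u"
  shows "sinsq_subsolution \<alpha> H u"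
  unfolding sinsq_subsolution_def
proof (intro allI impI, elim conjE)
  fix x0 t0 \<delta> a y f f'
  assume *: "0 < \<delta>" "\<delta> < t0" "\<forall>t>0. (f has_real_derivative f' t) (at t)"
      "continuous_on {0<..} f'"
      "\<forall>x. \<forall>t\<ge>0. u x t - a * sinsq (x - y) - f t \<le> u x0 t0 - a * sinsq (x0 - y) - f t0"
  have "visc_lhs \<alpha> H u (\<lambda>x t. a * sinsq (x - y) + f t) \<delta> x0 t0 \<le> 0"
  proof (rule assms[unfolded visc_subsolution_def, rule_format], intro conjI ballI)
    show "test_function (\<lambda>x t. a * sinsq (x - y) + f t)"
      using * by (intro test_function_sinsq) auto
    fix x t assume "t \<in> {t0 - \<delta>..t0 + \<delta>}"
    then show "u x t - (a * sinsq (x - y) + f t) \<le> u x0 t0 - (a * sinsq (x0 - y) + f t0)"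
      using *(2) *(5)[rule_format, of t x] by auto
  qed (use * in auto)
  then show "frac_tail \<alpha> \<delta> (\<lambda>s. u x0 (max s 0)) t0 + frac_near \<alpha> \<delta> f t0
              + H x0 (a *\<^sub>R sinsq_grad (x0 - y)) \<le> 0"
    using visc_lhs_sinsq[OF *(1)] by metis
qed

text \<open>Passing to -u lets lemmas on subsolutions serve both signs. The reflected Hamiltonian
  tends to minus infinity for a coercive \<open>H\<close>, so this covers only arguments that do not
  use coercivity.\<close>

lemma visc_supersolution_imp:
  assumes "visc_supersolution \<alpha> H u"
  shows "sinsq_subsolution \<alpha> (\<lambda>x p. - H x (- p)) (\<lambda>x t. - u x t)"
  unfolding sinsq_subsolution_def
proof (intro allI impI, elim conjE)
  fix x0 t0 \<delta> a y f f'
  assume *: "0 < \<delta>" "\<delta> < t0" "\<forall>t>0. (f has_real_derivative f' t) (at t)"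
      "continuous_on {0<..} f'"
      "\<forall>x. \<forall>t\<ge>0. - u x t - a * sinsq (x - y) - f t \<le> - u x0 t0 - a * sinsq (x0 - y) - f t0"
  have "visc_lhs \<alpha> H u (\<lambda>x t. - a * sinsq (x - y) + - f t) \<delta> x0 t0 \<ge> 0"
  proof (rule assms[unfolded visc_supersolution_def, rule_format], intro conjI ballI)
    show "test_function (\<lambda>x t. - a * sinsq (x - y) + - f t)"
      using * by (intro test_function_sinsq[where f' = "\<lambda>t. - f' t"])
        (auto intro!: DERIV_minus continuous_intros)
    fix x t assume "t \<in> {t0 - \<delta>..t0 + \<delta>}"
    then show "u x t - (- a * sinsq (x - y) + - f t) \<ge> u x0 t0 - (- a * sinsq (x0 - y) + - f t0)"
      using *(2) *(5)[rule_format, of t x] by auto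
  qed (use * in auto)
  then have "0 \<le> frac_tail \<alpha> \<delta> (\<lambda>s. u x0 (max s 0)) t0 + frac_near \<alpha> \<delta> (\<lambda>t. - f t) t0
              + H x0 (- a *\<^sub>R sinsq_grad (x0 - y))"
    using visc_lhs_sinsq[OF *(1)] by metis
  moreover have "frac_near \<alpha> \<delta> (\<lambda>t. - f t) t0 = - frac_near \<alpha> \<delta> f t0"
    unfolding frac_near_def Bochner_Integration.integral_minus[symmetric]
    by (rule Bochner_Integration.integral_cong) (simp_all add: indicator_def diff_divide_distrib)
  moreover have "frac_tail \<alpha> \<delta> (\<lambda>s. - u x0 (max s 0)) t0 = - frac_tail \<alpha> \<delta> (\<lambda>s. u x0 (max s 0)) t0"
    unfolding frac_tail_def Bochner_Integration.integral_minus[symmetric]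
    by (rule Bochner_Integration.integral_cong) (simp_all add: indicator_def diff_divide_distrib)
  ultimately show "frac_tail \<alpha> \<delta> (\<lambda>s. - u x0 (max s 0)) t0 + frac_near \<alpha> \<delta> f t0
              + - H x0 (- (a *\<^sub>R sinsq_grad (x0 - y))) \<le> 0"
    by simp
qed

section \<open>Existence of maximum points\<close>

lemma attains_sup_reduction:
  fixes F :: "'a::topological_space \<Rightarrow> real"
  assumes "continuous_on S F" "K \<subseteq> S" "compact K" "K \<noteq> {}"
    and "\<And>p. p \<in> S \<Longrightarrow> \<exists>q\<in>K. F p \<le> F q"
  obtains m where "m \<in> K" "\<And>p. p \<in> S \<Longrightarrow> F p \<le> F m"
proof -
  obtain m where "m \<in> K" "\<forall>q\<in>K. F q \<le> F m"
    using continuous_attains_sup[OF assms(3,4) continuous_on_subset[OF assms(1,2)]] by blast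
  then show ?thesis
    using assms(5) that by (meson order_trans)
qed

text \<open>Lattice translations bring any point into the unit cube, so a maximum could only be lost
  at large times; \<open>far\<close> rules this out.\<close>

lemma periodic_attains_sup:
  fixes F :: "real ^ 'n \<Rightarrow> real \<Rightarrow> real"
  assumes cont: "continuous_on (UNIV \<times> {0..}) (\<lambda>(x, t). F x t)"
    and per: "\<And>t. 0 \<le> t \<Longrightarrow> periodic (\<lambda>x. F x t)"
    and far: "\<And>x t. T < t \<Longrightarrow> F x t \<le> F x1 t1" and t1: "0 \<le> t1" "t1 \<le> T"
  obtains x0 t0 where "0 \<le> t0" "\<And>x t. 0 \<le> t \<Longrightarrow> F x t \<le> F x0 t0"
proof -
  let ?K = "cbox 0 (\<chi> i. 1) \<times> {0..T} :: ((real ^ 'n) \<times> real) set"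
  have near: "\<exists>q\<in>?K. F x t \<le> (\<lambda>(x, t). F x t) q" if t: "0 \<le> t" "t \<le> T" for x t
  proof -
    obtain k where k: "k \<in> int_lattice" "x + k \<in> cbox 0 (\<chi> i. 1)"
      using ex_lattice_cbox by blast
    then show ?thesis
      using periodicD[OF per[OF t(1)] k(1), of x] t by (intro bexI[of _ "(x + k, t)"]) auto
  qed
  have "\<exists>q\<in>?K. F x t \<le> (\<lambda>(x, t). F x t) q" if "0 \<le> t" for x t
  proof (cases "t \<le> T")
    case True
    then show ?thesis
      using near that by blast
  next
    case False
    then show ?thesis
      using near[OF t1, of x1] far[of t x] by (meson not_le order_trans)
  qed
  then have red: "\<exists>q\<in>?K. (\<lambda>(x, t). F x t) p \<le> (\<lambda>(x, t). F x t) q" if "p \<in> UNIV \<times> {0..}" for p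
    using that by auto
  obtain m where "m \<in> ?K" and m: "\<And>p. p \<in> UNIV \<times> {0..} \<Longrightarrow> (\<lambda>(x, t). F x t) p \<le> (\<lambda>(x, t). F x t) m"
  proof (rule attains_sup_reduction[OF cont _ _ _ red])
    show "compact ?K"
      by (intro compact_Times compact_cbox) auto
    show "?K \<noteq> {}"
      using near[OF t1] by blast
  qed auto
  then show ?thesis
    using that[of "snd m" "fst m"] m[of "(_, _)"] by (auto simp: case_prod_beta)
qed

section \<open>Growth from the initial datum\<close>

lemma frac_tail_ge:
  fixes w :: "real \<Rightarrow> real"
  assumes "0 < \<alpha>" "0 < \<delta>" "continuous_on UNIV w" "\<And>s. \<bar>w s\<bar> \<le> R" "integrable lborel g"
    and "\<And>r. r < \<delta> \<Longrightarrow> g r \<le> 0"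
    and "\<And>r. \<delta> \<le> r \<Longrightarrow> g r \<le> (w t - w (t - r)) / r powr (1 + \<alpha>)"
  shows "integral\<^sup>L lborel g \<le> frac_tail \<alpha> \<delta> w t"
  unfolding frac_tail_def
proof (rule integral_mono[OF assms(5) frac_tail_integrable[OF assms(1-4)]])
  show "g r \<le> indicator {\<delta>..} r * ((w t - w (t - r)) / r powr (1 + \<alpha>))" for r
    using assms(6,7)[of r] by (auto simp: indicator_def not_le)
qed

text \<open>This is (sqrt r - sqrt s)^2 \<ge> 0, divided by 2 sqrt s. It turns barriers with a
  square root into admissible ones that are affine in \<open>sinsq\<close>.\<close>

lemma sqrt_tangent:
  fixes r s :: real
  assumes "0 < s" "0 \<le> r"
  shows "sqrt r \<le> sqrt s + (r - s) / (2 * sqrt s)"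
proof -
  have "2 * sqrt s * sqrt r \<le> r + s"
    using sum_squares_ge_zero[of "sqrt r - sqrt s" 0] assms by (simp add: algebra_simps)
  moreover have "2 * sqrt s * (sqrt s + (r - s) / (2 * sqrt s)) = r + s"
    using assms by (simp add: field_simps)
  ultimately have "2 * sqrt s * sqrt r \<le> 2 * sqrt s * (sqrt s + (r - s) / (2 * sqrt s))"
    by simp
  then show ?thesis
    using assms by (simp only: mult_le_cancel_left_pos mult_pos_pos real_sqrt_gt_zero zero_less_numeral)
qed

lemma powr_power_inverse: "0 < \<alpha> \<Longrightarrow> 0 \<le> z \<Longrightarrow> (z powr (1 / \<alpha>)) powr \<alpha> = (z::real)"
  by (simp add: powr_powr)

text \<open>
  A smooth majorant of the Lipschitz initial datum at \<open>y\<close>, plus \<open>C t\<^sup>\<alpha>\<close>, is a strict supersolution,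
  because the constant history before time 0 alone contributes \<open>C / \<alpha>\<close> to the fractional
  derivative of \<open>C t\<^sup>\<alpha>\<close>.
\<close>

lemma initial_growth:
  fixes u :: "real ^ 'n \<Rightarrow> real \<Rightarrow> real"
  assumes \<alpha>: "0 < \<alpha>" "\<alpha> < 1"
    and sub: "sinsq_subsolution \<alpha> H u"
    and cont: "continuous_on (UNIV \<times> {0..}) (\<lambda>(x, t). u x t)"
    and per: "\<And>t. 0 \<le> t \<Longrightarrow> periodic (\<lambda>x. u x t)"
    and bound: "\<And>x t. 0 \<le> t \<Longrightarrow> \<bar>u x t\<bar> \<le> R"
    and L: "0 \<le> L" "\<And>x y. u x 0 - u y 0 \<le> L * sqrt (sinsq (x - y))"
    and B: "0 < B" "\<And>x p. norm p \<le> pi * L \<Longrightarrow> - B < H x p"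
    and t: "0 \<le> t"
  shows "u y t \<le> u y 0 + \<alpha> * B * t powr \<alpha>"
proof -
  define C where "C = \<alpha> * B"
  have C: "0 < C"
    using \<alpha> B by (simp add: C_def)
  have R: "0 \<le> R"
    using bound[of 0 0] by simp
  \<comment> \<open>The parameter \<rho> smooths the cone \<open>L * sqrt (sinsq (x - y))\<close> at
    its vertex. It raises the barrier there by \<open>L * \<rho>\<close> and is sent to 0 at the
    end.\<close>
  have main: "u y t \<le> u y 0 + C * t powr \<alpha> + L * \<rho>" if \<rho>: "0 < \<rho>" for \<rho>
  proof (rule ccontr)
    assume contr: "\<not> ?thesis"
    define N where "N = (\<lambda>x. sqrt (\<rho>\<^sup>2 + sinsq (x - y)))"
    define F where "F = (\<lambda>x t. u x t - L * N x - C * t powr \<alpha>)"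
    have Fy: "u y 0 < F y t"
      using contr \<rho> by (simp add: F_def N_def)
    have Nge: "sqrt (sinsq (x - y)) \<le> N x" "0 < N x" for x
      using \<rho> by (simp_all add: N_def add_pos_nonneg)
    obtain x0 t0 where t0: "0 \<le> t0" and max: "\<And>x t. 0 \<le> t \<Longrightarrow> F x t \<le> F x0 t0"
    \<comment> \<open>Past this time \<open>C * s powr \<alpha>\<close> is at least
      \<open>2 * R\<close> plus all that is subtracted in \<open>F y t\<close>, so \<open>F\<close>
      cannot exceed \<open>F y t\<close> there.\<close>
    proof (rule periodic_attains_sup[of F "t + ((2 * R + L * N y + C * t powr \<alpha>) / C) powr (1 / \<alpha>)" y t])
      have "continuous_on (UNIV \<times> {0..}) (\<lambda>z. (\<lambda>(x, t). u x t) z - L * N (fst z) - C * snd z powr \<alpha>)"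
        unfolding N_def
        by (intro continuous_on_diff continuous_on_mult continuous_on_powr' continuous_intros cont)
          (use \<alpha> in auto)
      then show "continuous_on (UNIV \<times> {0..}) (\<lambda>(x, t). F x t)"
        by (simp add: F_def case_prod_beta')
      show "periodic (\<lambda>x. F x t)" if "0 \<le> t" for t
        using per[OF that] sinsq_add_lattice[of _ "_ - y"] unfolding periodic_def F_def N_def
        by (metis diff_add_eq)
      show "0 \<le> t" "t \<le> t + ((2 * R + L * N y + C * t powr \<alpha>) / C) powr (1 / \<alpha>)"
        using t by auto
      fix x s
      assume s: "t + ((2 * R + L * N y + C * t powr \<alpha>) / C) powr (1 / \<alpha>) < s"
      have s0: "0 \<le> s"
        using s t powr_ge_zero[of "(2 * R + L * N y + C * t powr \<alpha>) / C" "1 / \<alpha>"] by linarith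
      have "(2 * R + L * N y + C * t powr \<alpha>) / C
          = (((2 * R + L * N y + C * t powr \<alpha>) / C) powr (1 / \<alpha>)) powr \<alpha>"
        using R L C \<alpha> Nge(2)[of y] by (subst powr_power_inverse) auto
      also have "\<dots> \<le> s powr \<alpha>"
        using s t \<alpha> by (intro powr_mono2) auto
      finally have "2 * R + L * N y + C * t powr \<alpha> \<le> C * s powr \<alpha>"
        using C by (simp add: field_simps)
      moreover have "0 \<le> L * N x"
        using L Nge(2)[of x] by simp
      ultimately show "F x s \<le> F y t"
        using bound[OF s0, of x] bound[OF t, of y] unfolding F_def by linarith
    qed blast
    have F0: "u y 0 < F x0 t0"
      using Fy max[OF t, of y] by linarith
    have "t0 \<noteq> 0"
    proof
      assume "t0 = 0"
      then have "F x0 t0 = u x0 0 - L * N x0"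
        by (simp add: F_def)
      moreover have "u x0 0 - u y 0 \<le> L * N x0"
        using L(2)[of x0 y] mult_left_mono[OF Nge(1)[of x0] L(1)] by linarith
      ultimately show False
        using F0 by linarith
    qed
    with t0 have t0: "0 < t0"
      by simp
    \<comment> \<open>The slope of \<open>L * N\<close>, as a concave function of
      \<open>sinsq (x - y)\<close>, at the maximum point.\<close>
    define a where "a = L / (2 * N x0)"
    have tangent: "L * N x \<le> L * N x0 + a * (sinsq (x - y) - sinsq (x0 - y))" for x
    proof -
      have "N x \<le> N x0 + (sinsq (x - y) - sinsq (x0 - y)) / (2 * N x0)"
        using sqrt_tangent[of "\<rho>\<^sup>2 + sinsq (x0 - y)" "\<rho>\<^sup>2 + sinsq (x - y)"] \<rho>
        by (simp add: N_def add_pos_nonneg)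
      from mult_left_mono[OF this L(1)] show ?thesis
        by (simp add: a_def distrib_left)
    qed
    let ?w = "\<lambda>s. u x0 (max s 0)"
    have growth: "C * (t0 powr \<alpha> - s powr \<alpha>) \<le> u x0 t0 - u x0 s" if "0 \<le> s" for s
      using max[OF that, of x0] by (simp add: F_def algebra_simps)
    have "frac_tail \<alpha> (t0 / 2) ?w t0 + frac_near \<alpha> (t0 / 2) (\<lambda>t. C * t powr \<alpha>) t0
        + H x0 (a *\<^sub>R sinsq_grad (x0 - y)) \<le> 0"
    proof (rule sinsq_subsolutionD[OF sub])
      show "((\<lambda>t. C * t powr \<alpha>) has_real_derivative C * (\<alpha> * t powr (\<alpha> - 1))) (at t)" if "0 < t" for t
        using that by (auto intro!: derivative_eq_intros simp: powr_diff)
      show "continuous_on {0<..} (\<lambda>t. C * (\<alpha> * t powr (\<alpha> - 1)))"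
        by (intro continuous_intros) auto
      show "u x t - a * sinsq (x - y) - C * t powr \<alpha>
          \<le> u x0 t0 - a * sinsq (x0 - y) - C * t0 powr \<alpha>" if "0 \<le> t" for x t
        using max[OF that, of x] tangent[of x] by (simp add: F_def algebra_simps)
    qed (use t0 in auto)
    moreover have "0 \<le> frac_near \<alpha> (t0 / 2) (\<lambda>t. C * t powr \<alpha>) t0"
      using frac_near_ge[of \<alpha> "t0 / 2" 0 "\<lambda>t. C * t powr \<alpha>" t0] \<alpha> t0 C
      by (simp add: powr_mono2)
    moreover have "B \<le> frac_tail \<alpha> (t0 / 2) ?w t0"
    proof -
      \<comment> \<open>Only the history before time 0, that is lags from \<open>t0\<close> on, is
        counted; shorter lags contribute a nonnegative amount by \<open>growth\<close>. With C =
        \<alpha> B the value is exactly B, which beats \<open>H\<close> > -B.\<close>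
      let ?g = "\<lambda>r. C * t0 powr \<alpha> * (indicator {t0..} r * (1 / r powr (1 + \<alpha>)))"
      note k = tail_kernel[OF t0 \<alpha>(1)]
      have "B = C * t0 powr \<alpha> * (t0 powr - \<alpha> / \<alpha>)"
        using \<alpha> t0 by (simp add: C_def powr_minus field_simps)
      also have "\<dots> = integral\<^sup>L lborel ?g"
        by (simp only: integral_mult_right_zero has_bochner_integral_integral_eq[OF k])
      also have "\<dots> \<le> frac_tail \<alpha> (t0 / 2) ?w t0"
      proof (rule frac_tail_ge)
        show "continuous_on UNIV ?w"
          by (rule continuous_on_at_point[OF cont])
        show "\<bar>?w s\<bar> \<le> R" for s
          by (rule bound) simp
        show "integrable lborel ?g"
          using integrable.intros[OF k] by (rule integrable_mult_right)
        show "?g r \<le> 0" if "r < t0 / 2" for r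
          using that t0 by simp
        show "?g r \<le> (?w t0 - ?w (t0 - r)) / r powr (1 + \<alpha>)" if r: "t0 / 2 \<le> r" for r
        proof (cases "t0 \<le> r")
          case True
          then have "C * t0 powr \<alpha> \<le> ?w t0 - ?w (t0 - r)"
            using growth[of 0] t0 by (simp add: max_def)
          then show ?thesis
            using True divide_right_mono[of "C * t0 powr \<alpha>" _ "r powr (1 + \<alpha>)"] by simp
        next
          case False
          then have "0 \<le> C * (t0 powr \<alpha> - (t0 - r) powr \<alpha>)"
            using r t0 C \<alpha> by (simp add: powr_mono2)
          then show ?thesis
            using False t0 growth[of "t0 - r"] by (simp add: max_def)
        qed
      qed (use \<alpha> t0 in auto)
      finally show ?thesis .
    qed
    \<comment> \<open>This slope bound is the origin of the radius \<open>pi * L\<close> in the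
      hypothesis on \<open>B\<close>.\<close>
    moreover have "norm (a *\<^sub>R sinsq_grad (x0 - y)) \<le> pi * L"
    proof -
      have a: "0 \<le> a"
        using L(1) Nge(2)[of x0] by (simp add: a_def)
      have "norm (sinsq_grad (x0 - y)) \<le> 2 * pi * N x0"
        by (intro order_trans[OF norm_sinsq_grad_le] mult_left_mono Nge(1)) simp
      from mult_left_mono[OF this a] have "norm (a *\<^sub>R sinsq_grad (x0 - y)) \<le> a * (2 * pi * N x0)"
        using a by simp
      also have "\<dots> = pi * L"
        using Nge(2)[of x0] by (simp add: a_def)
      finally show ?thesis .
    qed
    ultimately show False
      using B(2)[of "a *\<^sub>R sinsq_grad (x0 - y)" x0] by linarith
  qed
  show ?thesis
  proof (rule field_le_epsilon)
    fix e :: real assume "0 < e"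
    then have "L * (e / (L + 1)) \<le> e" "0 < e / (L + 1)"
      using L(1) by (auto simp: field_simps)
    then show "u y t \<le> u y 0 + \<alpha> * B * t powr \<alpha> + e"
      using main[of "e / (L + 1)"] by (simp add: C_def)
  qed
qed

section \<open>Regularity in time\<close>

text \<open>As a function of z^2, C |z|^\<alpha> is concave, and \<open>e + b * z\<^sup>2\<close> is
  its tangent at z1^2; the inequality is Young's with weights \<alpha>/2 and 1 - \<alpha>/2. It
  replaces the Hoelder function, not differentiable at 0, by a smooth penalisation touching it at
  the gap where the bound is supposed to fail.\<close>

lemma quadratic_majorant:
  fixes z1 :: real
  assumes "z1 \<noteq> 0" "0 < \<alpha>" "\<alpha> < 2" "0 < C"
  obtains e b where "0 < b" "e + b * z1\<^sup>2 = C * \<bar>z1\<bar> powr \<alpha>" "\<And>z. C * \<bar>z\<bar> powr \<alpha> \<le> e + b * z\<^sup>2"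
proof
  let ?P = "\<bar>z1\<bar> powr \<alpha>"
  let ?e = "C * ?P * (1 - \<alpha> / 2)" and ?b = "C * ?P * (\<alpha> / 2) / z1\<^sup>2"
  show "0 < ?b"
    using assms by simp
  show "?e + ?b * z1\<^sup>2 = C * ?P"
    using assms by (simp add: field_simps)
  show "C * \<bar>z\<bar> powr \<alpha> \<le> ?e + ?b * z\<^sup>2" for z
  proof (cases "z = 0")
    case True
    then show ?thesis
      using assms by simp
  next
    case False
    have "(z / z1)\<^sup>2 = \<bar>z / z1\<bar> powr 2"
      using False assms(1) by (simp add: powr_numeral power_divide)
    then have "((z / z1)\<^sup>2) powr (\<alpha> / 2) = \<bar>z / z1\<bar> powr \<alpha>"
      by (simp only: powr_powr) simp
    also have "\<dots> = \<bar>z\<bar> powr \<alpha> / ?P"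
      by (simp add: powr_divide)
    finally have "\<bar>z\<bar> powr \<alpha> / ?P \<le> (\<alpha> / 2) * (z / z1)\<^sup>2 + (1 - \<alpha> / 2)"
      using Youngs_inequality_0[of "\<alpha> / 2" "1 - \<alpha> / 2" "(z / z1)\<^sup>2" 1] False assms by simp
    from mult_left_mono[OF this, of "C * ?P"] show ?thesis
      using assms by (simp add: field_simps)
  qed
qed

text \<open>Triples in the cube where the difference reaches \<eta> form a compact set. By
  periodicity \<open>sinsq\<close> has no zero on it, hence a positive minimum. The modulus is only
  qualitative and depends on \<open>u\<close> and \<open>T\<close>; it serves to make the spatial
  penalty at a doubling maximum small.\<close>

lemma periodic_space_modulus:
  fixes u :: "real ^ 'n \<Rightarrow> real \<Rightarrow> real"
  assumes cont: "continuous_on (UNIV \<times> {0..}) (\<lambda>(x, t). u x t)"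
    and per: "\<And>t. 0 \<le> t \<Longrightarrow> periodic (\<lambda>x. u x t)"
    and \<eta>: "0 < \<eta>"
  obtains \<eta>' where "0 < \<eta>'"
    "\<And>x y t. 0 \<le> t \<Longrightarrow> t \<le> T \<Longrightarrow> sinsq (x - y) \<le> \<eta>' \<Longrightarrow> u x t - u y t \<le> \<eta>"
proof -
  let ?Q = "cbox 0 (\<chi> i. 1) :: (real ^ 'n) set"
  let ?K = "?Q \<times> ?Q \<times> {0..T}"
  define Z where "Z = {z \<in> ?K. \<eta> \<le> u (fst z) (snd (snd z)) - u (fst (snd z)) (snd (snd z))}"
  have K: "compact ?K"
    by (intro compact_Times compact_cbox) auto
  have c1: "continuous_on ?K (\<lambda>z. (\<lambda>(x, t). u x t) (fst z, snd (snd z)))"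
    by (rule continuous_on_compose2[OF cont]) (auto intro!: continuous_intros)
  have c2: "continuous_on ?K (\<lambda>z. (\<lambda>(x, t). u x t) (fst (snd z), snd (snd z)))"
    by (rule continuous_on_compose2[OF cont]) (auto intro!: continuous_intros)
  have "closed Z"
    unfolding Z_def using continuous_on_diff[OF c1 c2]
    by (intro continuous_on_closed_Collect_le compact_imp_closed[OF K] continuous_on_const)
      (simp only: prod.case)
  moreover have "Z \<subseteq> ?K"
    by (auto simp: Z_def)
  ultimately have Z: "compact Z"
    using compact_Int_closed[OF K] by (metis inf.absorb2)
  obtain \<eta>' where \<eta>': "0 < \<eta>'" "\<And>z. z \<in> Z \<Longrightarrow> \<eta>' < sinsq (fst z - fst (snd z))"
  proof (cases "Z = {}")
    case True
    then show ?thesis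
      using that[of 1] by auto
  next
    case False
    have "continuous_on Z (\<lambda>z. sinsq (fst z - fst (snd z)))"
      by (intro continuous_intros)
    then obtain m where m: "m \<in> Z" "\<forall>z\<in>Z. sinsq (fst m - fst (snd m)) \<le> sinsq (fst z - fst (snd z))"
      using continuous_attains_inf[OF Z False] by blast
    have "sinsq (fst m - fst (snd m)) \<noteq> 0"
    proof
      assume "sinsq (fst m - fst (snd m)) = 0"
      moreover have "0 \<le> snd (snd m)"
        using m(1) by (auto simp: Z_def)
      ultimately have "u (fst m) (snd (snd m)) = u (fst (snd m)) (snd (snd m))"
        using periodic_eq_if_sinsq_0[OF per] by blast
      then show False
        using m(1) \<eta> by (simp add: Z_def)
    qed
    then have "0 < sinsq (fst m - fst (snd m))"
      using sinsq_nonneg[of "fst m - fst (snd m)"] by linarith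
    then show ?thesis
      using that[of "sinsq (fst m - fst (snd m)) / 2"] m(2) by fastforce
  qed
  show ?thesis
  proof (rule that[OF \<eta>'(1)], rule ccontr)
    fix x y t
    assume t: "0 \<le> t" "t \<le> T" and sm: "sinsq (x - y) \<le> \<eta>'" and big: "\<not> u x t - u y t \<le> \<eta>"
    obtain k where k: "k \<in> int_lattice" "x + k \<in> ?Q"
      using ex_lattice_cbox by blast
    obtain l where l: "l \<in> int_lattice" "y + l \<in> ?Q"
      using ex_lattice_cbox by blast
    have "sinsq ((x + k) - (y + l)) = sinsq (x - y + k + - l)"
      by (simp add: algebra_simps)
    also have "\<dots> = sinsq (x - y)"
      by (simp only: sinsq_add_lattice[OF k(1)] sinsq_add_lattice[OF int_lattice_uminus[OF l(1)]])
    finally have "sinsq ((x + k) - (y + l)) = sinsq (x - y)" .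
    moreover have "(x + k, y + l, t) \<in> Z"
      using k l t big periodicD[OF per[OF t(1)]] by (simp add: Z_def)
    ultimately show False
      using \<eta>'(2)[of "(x + k, y + l, t)"] sm by simp
  qed
qed

text \<open>The bound \<open>T\<close> on the time of the maximum comes before the spatial weight
  \<open>A\<close>. This order matters: \<open>A\<close> is later chosen from the modulus of
  \<open>u\<close> on [0, T], which would be circular if \<open>T\<close> depended on
  \<open>A\<close>.\<close>

lemma doubling_max:
  fixes u :: "real ^ 'n \<Rightarrow> real \<Rightarrow> real"
  assumes \<alpha>: "0 < \<alpha>"
    and cont: "continuous_on (UNIV \<times> {0..}) (\<lambda>(x, t). u x t)"
    and per: "\<And>t. 0 \<le> t \<Longrightarrow> periodic (\<lambda>x. u x t)"
    and bound: "\<And>x t. 0 \<le> t \<Longrightarrow> \<bar>u x t\<bar> \<le> R"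
    and b: "0 < b" and \<sigma>: "0 < \<sigma>" and \<mu>: "0 < \<mu>" "\<mu> \<le> 1"
  obtains T where "\<And>A. 0 \<le> A \<Longrightarrow> \<exists>x0 y0 t0 s0. 0 \<le> t0 \<and> t0 \<le> T \<and> 0 \<le> s0 \<and>
    (\<forall>x y. \<forall>t\<ge>0. \<forall>s\<ge>0.
      \<mu> * u x t - u y s - A * sinsq (x - y) - b * (t - s)\<^sup>2 - \<sigma> * s powr \<alpha>
      \<le> \<mu> * u x0 t0 - u y0 s0 - A * sinsq (x0 - y0) - b * (t0 - s0)\<^sup>2 - \<sigma> * s0 powr \<alpha>)"
proof -
  have R: "0 \<le> R"
    using bound[of 0 0] by simp
  have \<mu>u: "\<bar>\<mu> * u x t\<bar> \<le> R" if "0 \<le> t" for x t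
  proof -
    have "\<mu> * \<bar>u x t\<bar> \<le> 1 * R"
      using \<mu> bound[OF that] by (intro mult_mono) auto
    then show ?thesis
      using \<mu> by (simp add: abs_mult)
  qed
  \<comment> \<open>Past \<open>S\<close> the penalty in \<open>s\<close> alone outweighs
    \<open>4 * R\<close>, the largest possible variation of the two values of \<open>u\<close>. If s
    \<le> S, a time gap of sqrt (4 R / b) does the same through the quadratic term.\<close>
  define S where "S = (4 * R / \<sigma>) powr (1 / \<alpha>)"
  define T where "T = S + sqrt (4 * R / b)"
  have S: "0 \<le> S" "S \<le> T" "0 \<le> T"
    using R b by (simp_all add: S_def T_def)
  have "\<exists>x0 y0 t0 s0. 0 \<le> t0 \<and> t0 \<le> T \<and> 0 \<le> s0 \<and>
    (\<forall>x y. \<forall>t\<ge>0. \<forall>s\<ge>0.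
      \<mu> * u x t - u y s - A * sinsq (x - y) - b * (t - s)\<^sup>2 - \<sigma> * s powr \<alpha>
      \<le> \<mu> * u x0 t0 - u y0 s0 - A * sinsq (x0 - y0) - b * (t0 - s0)\<^sup>2 - \<sigma> * s0 powr \<alpha>)"
    if A: "0 \<le> A" for A
  proof -
    define F where "F = (\<lambda>x y t s. \<mu> * u x t - u y s - A * sinsq (x - y) - b * (t - s)\<^sup>2 - \<sigma> * s powr \<alpha>)"
    define G where "G = (\<lambda>z :: ((real ^ 'n) \<times> real) \<times> ((real ^ 'n) \<times> real).
      F (fst (fst z)) (fst (snd z)) (snd (fst z)) (snd (snd z)))"
    let ?D = "UNIV \<times> {0..} :: ((real ^ 'n) \<times> real) set"
    let ?k = "cbox 0 (\<chi> i. 1) \<times> {0..T} :: ((real ^ 'n) \<times> real) set"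
    have far: "F x y t s \<le> F 0 0 0 0" if ts: "0 \<le> t" "0 \<le> s" "T < t \<or> T < s" for x y t s
    proof -
      have "4 * R \<le> b * (t - s)\<^sup>2 + \<sigma> * s powr \<alpha>"
      proof (cases "S < s")
        case True
        have "4 * R / \<sigma> = S powr \<alpha>"
          unfolding S_def using R \<sigma> \<alpha> by (subst powr_power_inverse) auto
        also have "\<dots> \<le> s powr \<alpha>"
          using True S \<alpha> by (intro powr_mono2) auto
        finally have "4 * R \<le> \<sigma> * s powr \<alpha>"
          using \<sigma> by (simp add: field_simps)
        then show ?thesis
          using b by (simp add: add_increasing)
      next
        case False
        then have "sqrt (4 * R / b) \<le> t - s"
          using ts(3) S(2) unfolding T_def by linarith
        then have "(sqrt (4 * R / b))\<^sup>2 \<le> (t - s)\<^sup>2"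
          using R b by (intro power_mono) auto
        then have "4 * R \<le> b * (t - s)\<^sup>2"
          using R b by (simp add: field_simps)
        then show ?thesis
          using \<sigma> by (simp add: add_increasing2)
      qed
      moreover have "0 \<le> A * sinsq (x - y)"
        using A by simp
      ultimately show ?thesis
        using \<mu>u[OF ts(1), of x] bound[OF ts(2), of y] \<mu>u[of 0 0] bound[of 0 0]
        unfolding F_def by simp
    qed
    have near: "\<exists>q\<in>?k \<times> ?k. F x y t s \<le> G q" if "0 \<le> t" "t \<le> T" "0 \<le> s" "s \<le> T" for x y t s
    proof -
      obtain k where k: "k \<in> int_lattice" "x + k \<in> cbox 0 (\<chi> i. 1)"
        using ex_lattice_cbox by blast
      obtain l where l: "l \<in> int_lattice" "y + l \<in> cbox 0 (\<chi> i. 1)"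
        using ex_lattice_cbox by blast
      have "sinsq ((x + k) - (y + l)) = sinsq (x - y + k + - l)"
        by (simp add: algebra_simps)
      also have "\<dots> = sinsq (x - y)"
        by (simp only: sinsq_add_lattice[OF k(1)] sinsq_add_lattice[OF int_lattice_uminus[OF l(1)]])
      finally have "F x y t s = G ((x + k, t), (y + l, s))"
        using periodicD[OF per k(1)] periodicD[OF per l(1)] that by (simp add: F_def G_def)
      then show ?thesis
        using k l that by (intro bexI[of _ "((x + k, t), (y + l, s))"]) auto
    qed
    have red: "\<exists>q\<in>?k \<times> ?k. G p \<le> G q" if "p \<in> ?D \<times> ?D" for p
    proof (cases "snd (fst p) \<le> T \<and> snd (snd p) \<le> T")
      case True
      then show ?thesis
        using near[of "snd (fst p)" "snd (snd p)"] that by (auto simp: G_def)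
    next
      case False
      then have "G p \<le> F 0 0 0 0"
        unfolding G_def using that by (intro far) auto
      then show ?thesis
        using near[of 0 0 0 0] S by (meson order_refl order_trans)
    qed
    have c1: "continuous_on (?D \<times> ?D) (\<lambda>z. (\<lambda>(x, t). u x t) (fst z))"
      by (rule continuous_on_compose2[OF cont]) (auto intro!: continuous_intros)
    have c2: "continuous_on (?D \<times> ?D) (\<lambda>z. (\<lambda>(x, t). u x t) (snd z))"
      by (rule continuous_on_compose2[OF cont]) (auto intro!: continuous_intros)
    have "continuous_on (?D \<times> ?D) (\<lambda>z. \<mu> * (\<lambda>(x, t). u x t) (fst z) - (\<lambda>(x, t). u x t) (snd z)
      - A * sinsq (fst (fst z) - fst (snd z)) - b * (snd (fst z) - snd (snd z))\<^sup>2
      - \<sigma> * snd (snd z) powr \<alpha>)"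
      by (intro continuous_on_diff continuous_on_mult continuous_on_powr' c1 c2 continuous_intros)
        (use \<alpha> in auto)
    then have "continuous_on (?D \<times> ?D) G"
      by (simp add: G_def F_def case_prod_beta')
    then obtain m where m: "m \<in> ?k \<times> ?k" "\<And>p. p \<in> ?D \<times> ?D \<Longrightarrow> G p \<le> G m"
    proof (rule attains_sup_reduction[OF _ _ _ _ red])
      show "compact (?k \<times> ?k)"
        by (intro compact_Times compact_cbox) auto
      show "?k \<times> ?k \<noteq> {}"
        using near[of 0 0] S by blast
    qed (auto simp: S)
    have "F x y t s \<le> F (fst (fst m)) (fst (snd m)) (snd (fst m)) (snd (snd m))"
      if "0 \<le> t" "0 \<le> s" for x y t s
      using m(2)[of "((x, t), (y, s))"] that by (simp add: G_def)
    then show ?thesis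
      using m(1) unfolding F_def
      by (intro exI[of _ "fst (fst m)"] exI[of _ "fst (snd m)"] exI[of _ "snd (fst m)"]
          exI[of _ "snd (snd m)"]) auto
  qed
  then show ?thesis
    by (rule that)
qed


text \<open>
  The common consequence of (A), with \<open>\<mu> = 1\<close>, and (B), with \<open>\<mu> < 1\<close>, that makes doubling of
  variables work: \<open>a *\<^sub>R sinsq_grad (x - y)\<close> is the gradient of the penalisation
  \<open>a * sinsq (x - y)\<close>.
\<close>

definition doubling_cond :: "(real ^ 'n \<Rightarrow> real ^ 'n \<Rightarrow> real) \<Rightarrow> bool" where
  "doubling_cond H \<longleftrightarrow> (\<forall>\<kappa>>0. \<exists>\<mu>>0. \<mu> \<le> 1 \<and> 1 - \<mu> \<le> \<kappa> \<and>
     (\<exists>\<eta>>0. \<forall>x y a. 0 \<le> a \<and> sinsq (x - y) \<le> \<eta> \<and> a * sinsq (x - y) \<le> \<eta> \<longrightarrow>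
        - \<kappa> \<le> \<mu> * H x ((a / \<mu>) *\<^sub>R sinsq_grad (x - y)) - H y (a *\<^sub>R sinsq_grad (x - y))))"

lemma doubling_condE:
  assumes "doubling_cond H" "0 < \<kappa>"
  obtains \<mu> \<eta> where "0 < \<mu>" "\<mu> \<le> 1" "1 - \<mu> \<le> \<kappa>" "0 < \<eta>"
    "\<And>x y a. 0 \<le> a \<Longrightarrow> sinsq (x - y) \<le> \<eta> \<Longrightarrow> a * sinsq (x - y) \<le> \<eta> \<Longrightarrow>
        - \<kappa> \<le> \<mu> * H x ((a / \<mu>) *\<^sub>R sinsq_grad (x - y)) - H y (a *\<^sub>R sinsq_grad (x - y))"
proof -
  define P where "P = (\<lambda>\<mu> \<eta>. \<forall>x y a. 0 \<le> a \<and> sinsq (x - y) \<le> \<eta> \<and> a * sinsq (x - y) \<le> \<eta> \<longrightarrow>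
        - \<kappa> \<le> \<mu> * H x ((a / \<mu>) *\<^sub>R sinsq_grad (x - y)) - H y (a *\<^sub>R sinsq_grad (x - y)))"
  have "\<exists>\<mu>>0. \<mu> \<le> 1 \<and> 1 - \<mu> \<le> \<kappa> \<and> (\<exists>\<eta>>0. P \<mu> \<eta>)"
    unfolding P_def by (rule mp[OF spec[OF assms(1)[unfolded doubling_cond_def]] assms(2)])
  then obtain \<mu> \<eta> where *: "0 < \<mu>" "\<mu> \<le> 1" "1 - \<mu> \<le> \<kappa>" "0 < \<eta>" and "P \<mu> \<eta>"
    by blast
  from this(5) show ?thesis
    by (intro that[OF *]) (simp add: P_def)
qed

text \<open>Neither tail has a sign at a doubling maximum; only the sum at equal lags does, because
  shifting both times by the same amount leaves the penalty in t - s unchanged.\<close>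

lemma frac_tail_combine:
  fixes w1 w2 :: "real \<Rightarrow> real"
  assumes "0 < \<alpha>" "0 < \<delta>" "continuous_on UNIV w1" "\<And>s. \<bar>w1 s\<bar> \<le> R1"
    "continuous_on UNIV w2" "\<And>s. \<bar>w2 s\<bar> \<le> R2"
  shows "frac_tail \<alpha> \<delta> (\<lambda>\<rho>. \<mu> * w1 (t + \<rho>) + w2 (s + \<rho>)) 0 = \<mu> * frac_tail \<alpha> \<delta> w1 t + frac_tail \<alpha> \<delta> w2 s"
proof -
  let ?k = "\<lambda>w t r. indicator {\<delta>..} r * ((w t - w (t - r)) / r powr (1 + \<alpha>))"
  have "\<mu> * frac_tail \<alpha> \<delta> w1 t + frac_tail \<alpha> \<delta> w2 s = (\<integral>r. \<mu> * ?k w1 t r + ?k w2 s r \<partial>lborel)"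
    unfolding frac_tail_def
    by (subst Bochner_Integration.integral_add)
      (simp_all only: integrable_mult_right frac_tail_integrable[OF assms(1-4)]
        frac_tail_integrable[OF assms(1,2,5,6)] integral_mult_right_zero)
  also have "\<dots> = frac_tail \<alpha> \<delta> (\<lambda>\<rho>. \<mu> * w1 (t + \<rho>) + w2 (s + \<rho>)) 0"
    unfolding frac_tail_def
    by (rule Bochner_Integration.integral_cong)
      (auto simp: indicator_def add_divide_distrib diff_divide_distrib algebra_simps)
  finally show ?thesis ..
qed

lemma square_increment:
  fixes b c t r :: real
  assumes "0 \<le> b" "0 \<le> r" "r \<le> 1"
  shows "- (b * (2 * \<bar>t - c\<bar> + 1)) * r \<le> b * (t - c)\<^sup>2 - b * (t - r - c)\<^sup>2"
proof -
  have "r * r \<le> r * 1"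
    using assms by (intro mult_left_mono) auto
  moreover have "- (\<bar>t - c\<bar> * r) \<le> (t - c) * r"
    using assms abs_ge_minus_self[of "(t - c) * r"] by (simp add: abs_mult)
  ultimately have "- ((2 * \<bar>t - c\<bar> + 1) * r) \<le> (t - c)\<^sup>2 - (t - r - c)\<^sup>2"
    by (simp add: power2_eq_square algebra_simps)
  from mult_left_mono[OF this assms(1)] show ?thesis
    by (simp add: algebra_simps)
qed

text \<open>A violation with excess \<open>d\<close> produces an interior doubling maximum. There
  the history gains \<sigma>/\<alpha>, while the two near integrals cost at most \<sigma>/(4
  \<alpha>) and the Hamiltonians at most \<sigma>/(2 \<alpha>), a contradiction. \<open>C\<close> is
  the constant of the bound at time 0, so nothing deteriorates in time.\<close>

lemma time_holder:
  fixes u :: "real ^ 'n \<Rightarrow> real \<Rightarrow> real"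
  assumes \<alpha>: "0 < \<alpha>" "\<alpha> < 1"
    and sub: "sinsq_subsolution \<alpha> H u"
    and sup: "sinsq_subsolution \<alpha> (\<lambda>x p. - H x (- p)) (\<lambda>x t. - u x t)"
    and cont: "continuous_on (UNIV \<times> {0..}) (\<lambda>(x, t). u x t)"
    and per: "\<And>t. 0 \<le> t \<Longrightarrow> periodic (\<lambda>x. u x t)"
    and bound: "\<And>x t. 0 \<le> t \<Longrightarrow> \<bar>u x t\<bar> \<le> R"
    and L: "0 \<le> L" "\<And>x y. u x 0 - u y 0 \<le> L * sqrt (sinsq (x - y))"
    and C: "0 < C" "\<And>x t. 0 \<le> t \<Longrightarrow> \<bar>u x t - u x 0\<bar> \<le> C * t powr \<alpha>"
    and dc: "doubling_cond H"
    and ts: "0 \<le> t1" "0 \<le> s1"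
  shows "u x t1 - u x s1 \<le> C * \<bar>t1 - s1\<bar> powr \<alpha>"
proof (rule ccontr)
  assume contr: "\<not> ?thesis"
  define d where "d = u x t1 - u x s1 - C * \<bar>t1 - s1\<bar> powr \<alpha>"
  have d: "0 < d"
    using contr by (simp add: d_def)
  have "t1 - s1 \<noteq> 0"
    using contr by auto
  then obtain e b where b: "0 < b" and e1: "e + b * (t1 - s1)\<^sup>2 = C * \<bar>t1 - s1\<bar> powr \<alpha>"
    and maj: "\<And>z. C * \<bar>z\<bar> powr \<alpha> \<le> e + b * z\<^sup>2"
    using quadratic_majorant[of "t1 - s1" \<alpha> C] \<alpha> C(1)
    by (metis less_trans one_less_numeral_iff semiring_norm(76))
  have R: "0 \<le> R"
    using bound[of 0 0] by simp
  \<comment> \<open>The excess \<open>d\<close> is spent in portions of d/8: on the penalty at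
    \<open>s1\<close>, on replacing \<open>u\<close> by \<open>\<mu> * u\<close>, and later on the
    spatial Lipschitz error \<open>L\<^sup>2 / (4 * A)\<close>.\<close>
  define \<sigma> where "\<sigma> = d / (8 * (s1 powr \<alpha> + 1))"
  have den: "0 < s1 powr \<alpha> + 1"
    by (simp add: add_nonneg_pos)
  have \<sigma>: "0 < \<sigma>" "\<sigma> * s1 powr \<alpha> \<le> d / 8"
    using d den by (simp_all add: \<sigma>_def field_simps)
  \<comment> \<open>The first bound keeps the error of the Hamiltonians at half of the gain
    \<sigma>/\<alpha>; the second keeps the error of the factor \<mu> within d/8.\<close>
  define \<kappa> where "\<kappa> = min (\<sigma> / (2 * \<alpha>)) (d / (8 * (R + 1)))"
  have \<kappa>: "0 < \<kappa>" "\<kappa> \<le> \<sigma> / (2 * \<alpha>)" "\<kappa> * R \<le> d / 8"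
  proof -
    show "0 < \<kappa>" "\<kappa> \<le> \<sigma> / (2 * \<alpha>)"
      using \<sigma> \<alpha> d R by (auto simp: \<kappa>_def)
    have "\<kappa> * R \<le> d / (8 * (R + 1)) * R"
      using R by (intro mult_right_mono) (auto simp: \<kappa>_def)
    also have "\<dots> \<le> d / 8"
      using R d by (simp add: field_simps)
    finally show "\<kappa> * R \<le> d / 8" .
  qed
  obtain \<mu> \<eta> where \<mu>: "0 < \<mu>" "\<mu> \<le> 1" "1 - \<mu> \<le> \<kappa>" and \<eta>: "0 < \<eta>"
    and H\<mu>: "\<And>x y a. 0 \<le> a \<Longrightarrow> sinsq (x - y) \<le> \<eta> \<Longrightarrow> a * sinsq (x - y) \<le> \<eta> \<Longrightarrow>
        - \<kappa> \<le> \<mu> * H x ((a / \<mu>) *\<^sub>R sinsq_grad (x - y)) - H y (a *\<^sub>R sinsq_grad (x - y))"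
    using doubling_condE[OF dc \<kappa>(1)] by metis
  have \<mu>R: "(1 - \<mu>) * R \<le> d / 8"
    using mult_right_mono[OF \<mu>(3) R] \<kappa>(3) by linarith
  have \<mu>u: "\<mu> * u x t \<le> u x t + (1 - \<mu>) * R" "u x t \<le> \<mu> * u x t + (1 - \<mu>) * R" if "0 \<le> t" for x t
  proof -
    have "(1 - \<mu>) * \<bar>u x t\<bar> \<le> (1 - \<mu>) * R"
      using \<mu> bound[OF that] by (intro mult_left_mono) auto
    then have "\<bar>(1 - \<mu>) * u x t\<bar> \<le> (1 - \<mu>) * R"
      using \<mu> by (simp add: abs_mult)
    then show "\<mu> * u x t \<le> u x t + (1 - \<mu>) * R" "u x t \<le> \<mu> * u x t + (1 - \<mu>) * R"
      by (simp_all add: algebra_simps abs_le_iff)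
  qed
  obtain T where T: "\<And>A. 0 \<le> A \<Longrightarrow> \<exists>x0 y0 t0 s0. 0 \<le> t0 \<and> t0 \<le> T \<and> 0 \<le> s0 \<and>
    (\<forall>x y. \<forall>t\<ge>0. \<forall>s\<ge>0.
      \<mu> * u x t - u y s - A * sinsq (x - y) - b * (t - s)\<^sup>2 - \<sigma> * s powr \<alpha>
      \<le> \<mu> * u x0 t0 - u y0 s0 - A * sinsq (x0 - y0) - b * (t0 - s0)\<^sup>2 - \<sigma> * s0 powr \<alpha>)"
    using doubling_max[OF \<alpha>(1) cont per bound b \<sigma>(1) \<mu>(1,2)] by blast
  obtain \<eta>' where \<eta>': "0 < \<eta>'"
    "\<And>x y t. 0 \<le> t \<Longrightarrow> t \<le> T \<Longrightarrow> sinsq (x - y) \<le> \<eta>' \<Longrightarrow> u x t - u y t \<le> \<eta>"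
    using periodic_space_modulus[OF cont per \<eta>] by blast
  \<comment> \<open>The second summand gives \<open>L\<^sup>2 / (4 * A) \<le> d / 8\<close>, the
    third forces \<open>sinsq (x0 - y0)\<close> below both \<eta> and \<eta>'.\<close>
  define A where "A = 1 + 2 * L\<^sup>2 / d + 2 * R / min \<eta> \<eta>'"
  have A: "0 < A" "2 * L\<^sup>2 / d \<le> A" "2 * R / min \<eta> \<eta>' \<le> A"
    using d R \<eta> \<eta>'(1) by (simp_all add: A_def add_pos_nonneg)
  have LA: "L\<^sup>2 / (4 * A) \<le> d / 8"
    using A(1,2) d by (simp add: field_simps)
  obtain x0 y0 t0 s0 where t0: "0 \<le> t0" "t0 \<le> T" and s0: "0 \<le> s0"
    and max: "\<And>x y t s. 0 \<le> t \<Longrightarrow> 0 \<le> s \<Longrightarrow>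
      \<mu> * u x t - u y s - A * sinsq (x - y) - b * (t - s)\<^sup>2 - \<sigma> * s powr \<alpha>
      \<le> \<mu> * u x0 t0 - u y0 s0 - A * sinsq (x0 - y0) - b * (t0 - s0)\<^sup>2 - \<sigma> * s0 powr \<alpha>"
    using T[OF less_imp_le[OF A(1)]] by blast
  define Q where "Q = sinsq (x0 - y0)"
  define E where "E = e + b * (t0 - s0)\<^sup>2"
  define M where "M = \<mu> * u x0 t0 - u y0 s0 - A * Q - E - \<sigma> * s0 powr \<alpha>"
  have Q: "0 \<le> Q"
    by (simp add: Q_def)
  have "\<mu> * u x t1 - u x s1 - b * (t1 - s1)\<^sup>2 - \<sigma> * s1 powr \<alpha> - e \<le> M"
    using max[OF ts, of x x] by (simp add: M_def E_def Q_def)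
  then have M: "3 * d / 4 \<le> M"
    using \<mu>u(2)[OF ts(1), of x] \<mu>R \<sigma>(2) e1 d_def by linarith
  \<comment> \<open>Comparison with the pair (y0, y0) at the same times. Boundedness of
    \<open>u\<close> then makes \<open>Q\<close> small, and with \<open>Q\<close> small the modulus
    in space makes even \<open>A * Q\<close> small, as \<open>doubling_cond\<close>
    requires.\<close>
  have AQ: "A * Q \<le> \<mu> * (u x0 t0 - u y0 t0)"
    using max[OF t0(1) s0, of y0 y0] by (simp add: Q_def algebra_simps)
  have small: "Q \<le> min \<eta> \<eta>'"
  proof -
    have "\<mu> * (u x0 t0 - u y0 t0) \<le> \<mu> * (2 * R)"
      using \<mu> bound[OF t0(1), of x0] bound[OF t0(1), of y0] by (intro mult_left_mono) auto
    also have "\<dots> \<le> 1 * (2 * R)"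
      using \<mu> R by (intro mult_right_mono) auto
    finally have "A * Q \<le> 2 * R"
      using AQ by simp
    also have "\<dots> \<le> A * min \<eta> \<eta>'"
      using A(3) \<eta> \<eta>'(1) by (simp add: field_simps)
    finally show ?thesis
      using A(1) by simp
  qed
  have AQ\<eta>: "A * Q \<le> \<eta>"
  proof -
    have "u x0 t0 - u y0 t0 \<le> \<eta>"
      using \<eta>'(2)[OF t0] small by (simp add: Q_def)
    then have "\<mu> * (u x0 t0 - u y0 t0) \<le> \<mu> * \<eta>"
      using \<mu> by (intro mult_left_mono) auto
    also have "\<dots> \<le> 1 * \<eta>"
      using \<mu> \<eta> by (intro mult_right_mono) auto
    finally show ?thesis
      using AQ by simp
  qed
  \<comment> \<open>If one of the times is 0, the bound at time 0 and the Lipschitz datum already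
    give the Hoelder estimate, up to L sqrt Q \<le> L^2/(4A) + A Q. So the value falls short of the
    maximum by d/2; this excludes a maximum at time 0 and also controls lags reaching into the
    past.\<close>
  have edge: "\<mu> * u x0 t - u y0 s \<le> M - d / 2 + A * Q + E"
    if "0 \<le> t" "0 \<le> s" "t = 0 \<or> s = 0" "\<bar>t - s\<bar> \<le> \<bar>t0 - s0\<bar>" for t s
  proof -
    have "u x0 t - u y0 s \<le> (u x0 0 - u y0 0) + C * \<bar>t - s\<bar> powr \<alpha>"
      using that(1-3) C(2)[OF that(1), of x0] C(2)[OF that(2), of y0] by auto
    moreover have "C * \<bar>t - s\<bar> powr \<alpha> \<le> C * \<bar>t0 - s0\<bar> powr \<alpha>"
      using C(1) \<alpha> that(4) by (intro mult_left_mono powr_mono2) auto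
    moreover have "L * sqrt Q \<le> L\<^sup>2 / (4 * A) + A * Q"
    proof -
      have "0 \<le> (2 * A * sqrt Q - L)\<^sup>2 / (4 * A)"
        using A(1) by simp
      also have "\<dots> = A * Q - L * sqrt Q + L\<^sup>2 / (4 * A)"
        using A(1) Q by (simp add: power2_diff power_mult_distrib field_simps power2_eq_square[of A])
      finally show ?thesis
        by simp
    qed
    ultimately show ?thesis
      using L(2)[of x0 y0] maj[of "t0 - s0"] \<mu>u(1)[OF that(1), of x0] M \<mu>R LA
      unfolding E_def Q_def by linarith
  qed
  have pos: "0 < t0" "0 < s0"
  proof -
    have "\<not> (t0 = 0 \<or> s0 = 0)"
    proof
      assume "t0 = 0 \<or> s0 = 0"
      then have "\<mu> * u x0 t0 - u y0 s0 \<le> M - d / 2 + A * Q + E"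
        using edge t0(1) s0 by simp
      moreover have "0 \<le> \<sigma> * s0 powr \<alpha>"
        using \<sigma>(1) by simp
      ultimately show False
        using d unfolding M_def by linarith
    qed
    then show "0 < t0" "0 < s0"
      using t0 s0 by auto
  qed
  define K where "K = b * (2 * \<bar>t0 - s0\<bar> + 1)"
  have K: "0 \<le> K"
    using b by (simp add: K_def)
  \<comment> \<open>Chosen so that \<delta>^(1-\<alpha>) \<le> \<xi> keeps the two near integrals
    together below \<sigma>/(4 \<alpha>).\<close>
  define \<xi> where "\<xi> = (1 - \<alpha>) * \<sigma> / (4 * \<alpha> * (2 * K + 1))"
  have \<xi>: "0 < \<xi>"
    using \<alpha> \<sigma> K by (simp add: \<xi>_def)
  define \<delta> where "\<delta> = min (min (t0 / 2) (s0 / 2)) (min 1 (\<xi> powr (1 / (1 - \<alpha>))))"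
  have \<delta>: "0 < \<delta>" "\<delta> < t0" "\<delta> < s0" "\<delta> \<le> 1" "\<delta> \<le> \<xi> powr (1 / (1 - \<alpha>))"
    using pos \<xi> by (auto simp: \<delta>_def)
  have K\<delta>: "2 * (K * (\<delta> powr (1 - \<alpha>) / (1 - \<alpha>))) \<le> \<sigma> / (4 * \<alpha>)"
  proof -
    have "\<delta> powr (1 - \<alpha>) \<le> (\<xi> powr (1 / (1 - \<alpha>))) powr (1 - \<alpha>)"
      using \<delta> \<alpha> by (intro powr_mono2) auto
    also have "\<dots> = \<xi>"
      using \<alpha> \<xi> by (intro powr_power_inverse) auto
    finally have "\<delta> powr (1 - \<alpha>) / (1 - \<alpha>) \<le> \<sigma> / (4 * \<alpha> * (2 * K + 1))"
      using \<alpha> by (simp add: \<xi>_def field_simps)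
    then have "2 * K * (\<delta> powr (1 - \<alpha>) / (1 - \<alpha>)) \<le> 2 * K * (\<sigma> / (4 * \<alpha> * (2 * K + 1)))"
      using K by (intro mult_left_mono) auto
    also have "\<dots> = (\<sigma> / (4 * \<alpha>)) * (2 * K / (2 * K + 1))"
      by simp
    also have "\<dots> \<le> (\<sigma> / (4 * \<alpha>)) * 1"
      using \<sigma> \<alpha> K by (intro mult_left_mono) auto
    finally show ?thesis
      by simp
  qed
  let ?w1 = "\<lambda>s. u x0 (max s 0)" and ?w2 = "\<lambda>s. - u y0 (max s 0)"
  let ?p = "sinsq_grad (x0 - y0)"
  \<comment> \<open>\<open>b\<close> and \<open>A\<close> are divided by \<mu> here because the test
    is on \<open>u\<close>, not on \<open>\<mu> * u\<close>; the inequality is multiplied by \<mu>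
    at the end.\<close>
  let ?f1 = "\<lambda>t. (b / \<mu>) * (t - s0)\<^sup>2" and ?f2 = "\<lambda>s. b * (s - t0)\<^sup>2 + \<sigma> * s powr \<alpha>"
  have 1: "frac_tail \<alpha> \<delta> ?w1 t0 + frac_near \<alpha> \<delta> ?f1 t0 + H x0 ((A / \<mu>) *\<^sub>R ?p) \<le> 0"
  proof (rule sinsq_subsolutionD[OF sub \<delta>(1,2)])
    show "(?f1 has_real_derivative (b / \<mu>) * (2 * (t - s0))) (at t)" for t
      using \<mu>(1) by (auto intro!: derivative_eq_intros)
    show "continuous_on {0<..} (\<lambda>t. (b / \<mu>) * (2 * (t - s0)))"
      by (intro continuous_intros)
    fix x t assume t: "(0::real) \<le> t"
    have "\<mu> * (u x t - A / \<mu> * sinsq (x - y0) - ?f1 t)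
        \<le> \<mu> * (u x0 t0 - A / \<mu> * sinsq (x0 - y0) - ?f1 t0)"
      using max[OF t s0, of x y0] \<mu>(1) by (simp add: right_diff_distrib)
    then show "u x t - A / \<mu> * sinsq (x - y0) - ?f1 t \<le> u x0 t0 - A / \<mu> * sinsq (x0 - y0) - ?f1 t0"
      using \<mu>(1) by (simp only: mult_le_cancel_left_pos)
  qed
  have 2: "frac_tail \<alpha> \<delta> ?w2 s0 + frac_near \<alpha> \<delta> ?f2 s0 + - H y0 (- (A *\<^sub>R sinsq_grad (y0 - x0))) \<le> 0"
  proof (rule sinsq_subsolutionD[OF sup \<delta>(1,3)])
    show "(?f2 has_real_derivative b * (2 * (t - t0)) + \<sigma> * (\<alpha> * t powr (\<alpha> - 1))) (at t)" if "0 < t" for t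
      using that by (auto intro!: derivative_eq_intros simp: powr_diff)
    show "continuous_on {0<..} (\<lambda>t. b * (2 * (t - t0)) + \<sigma> * (\<alpha> * t powr (\<alpha> - 1)))"
      by (intro continuous_intros) auto
    show "- u y s - A * sinsq (y - x0) - ?f2 s \<le> - u y0 s0 - A * sinsq (y0 - x0) - ?f2 s0"
      if s: "0 \<le> s" for y s
      using max[OF t0(1) s, of x0 y] by (simp add: sinsq_commute[of x0] power2_commute[of t0])
  qed
  have g: "- (A *\<^sub>R sinsq_grad (y0 - x0)) = A *\<^sub>R ?p"
    using sinsq_grad_minus[of "x0 - y0"] by simp
  have n1: "- (K * (\<delta> powr (1 - \<alpha>) / (1 - \<alpha>))) \<le> \<mu> * frac_near \<alpha> \<delta> ?f1 t0"
  proof -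
    have "- (K / \<mu>) * (\<delta> powr (1 - \<alpha>) / (1 - \<alpha>)) \<le> frac_near \<alpha> \<delta> ?f1 t0"
    proof (rule frac_near_ge)
      show "- (K / \<mu>) * r \<le> ?f1 t0 - ?f1 (t0 - r)" if "0 < r" "r \<le> \<delta>" for r
        using square_increment[of "b / \<mu>" r t0 s0] b \<mu> \<delta>(4) that by (simp add: K_def)
    qed (use \<alpha> \<delta> K \<mu> in auto)
    from mult_left_mono[OF this less_imp_le[OF \<mu>(1)]] show ?thesis
      using \<mu>(1) by simp
  qed
  have n2: "- (K * (\<delta> powr (1 - \<alpha>) / (1 - \<alpha>))) \<le> frac_near \<alpha> \<delta> ?f2 s0"
  proof -
    have "- K * (\<delta> powr (1 - \<alpha>) / (1 - \<alpha>)) \<le> frac_near \<alpha> \<delta> ?f2 s0"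
    proof (rule frac_near_ge)
      fix r assume r: "0 < r" "r \<le> \<delta>"
      have "\<sigma> * (s0 - r) powr \<alpha> \<le> \<sigma> * s0 powr \<alpha>"
        using r \<sigma> \<alpha> \<delta>(3) by (intro mult_left_mono powr_mono2) auto
      then show "- K * r \<le> ?f2 s0 - ?f2 (s0 - r)"
        using square_increment[of b r s0 t0] b \<delta>(4) r by (simp add: K_def abs_minus_commute)
    qed (use \<alpha> \<delta> K in auto)
    then show ?thesis
      by simp
  qed
  \<comment> \<open>As long as both shifted times are nonnegative, maximality makes the combined
    increment nonnegative. For longer lags \<open>edge\<close> bounds it below by
    \<open>\<sigma> * s0 powr \<alpha>\<close>, and integrating this over lags from
    \<open>s0\<close> on gives \<sigma>/\<alpha>.\<close>
  have tails: "\<sigma> / \<alpha> \<le> \<mu> * frac_tail \<alpha> \<delta> ?w1 t0 + frac_tail \<alpha> \<delta> ?w2 s0"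
  proof -
    let ?W = "\<lambda>\<rho>. \<mu> * ?w1 (t0 + \<rho>) + ?w2 (s0 + \<rho>)"
    let ?g = "\<lambda>r. \<sigma> * s0 powr \<alpha> * (indicator {s0..} r * (1 / r powr (1 + \<alpha>)))"
    note k = tail_kernel[OF pos(2) \<alpha>(1)]
    note c1 = continuous_on_at_point[OF cont, of x0]
    have c2: "continuous_on UNIV ?w2"
      by (intro continuous_on_minus continuous_on_at_point[OF cont])
    have b1: "\<bar>?w1 s\<bar> \<le> R" and b2: "\<bar>?w2 s\<bar> \<le> R" for s
      using bound[of "max s 0"] by auto
    have "\<sigma> / \<alpha> = \<sigma> * s0 powr \<alpha> * (s0 powr - \<alpha> / \<alpha>)"
      using \<alpha> pos by (simp add: powr_minus field_simps)
    also have "\<dots> = integral\<^sup>L lborel ?g"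
      by (simp only: integral_mult_right_zero has_bochner_integral_integral_eq[OF k])
    also have "\<dots> \<le> frac_tail \<alpha> \<delta> ?W 0"
    proof (rule frac_tail_ge[OF \<alpha>(1) \<delta>(1)])
      show "continuous_on UNIV ?W"
        by (intro continuous_on_add continuous_on_mult continuous_on_const
            continuous_on_compose2[OF c1] continuous_on_compose2[OF c2] continuous_on_id) auto
      show "\<bar>?W \<rho>\<bar> \<le> \<bar>\<mu>\<bar> * R + R" for \<rho>
        using mult_left_mono[OF b1[of "t0 + \<rho>"], of "\<bar>\<mu>\<bar>"] b2[of "s0 + \<rho>"]
          abs_triangle_ineq[of "\<mu> * ?w1 (t0 + \<rho>)" "?w2 (s0 + \<rho>)"] by (simp add: abs_mult)
      show "integrable lborel ?g"
        using integrable.intros[OF k] by (rule integrable_mult_right)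
      show "?g r \<le> 0" if "r < \<delta>" for r
        using that \<delta>(3) by simp
      fix r assume r: "\<delta> \<le> r"
      have "indicator {s0..} r * (\<sigma> * s0 powr \<alpha>) \<le> ?W 0 - ?W (0 - r)"
      proof (cases "r \<le> t0 \<and> r \<le> s0")
        case True
        then have W: "?W (0 - r) = \<mu> * u x0 (t0 - r) - u y0 (s0 - r)" "?W 0 = \<mu> * u x0 t0 - u y0 s0"
          using pos by (simp_all add: max.absorb1)
        have "\<sigma> * s0 powr \<alpha> - \<sigma> * (s0 - r) powr \<alpha> \<le> ?W 0 - ?W (0 - r)"
          unfolding W using max[of "t0 - r" "s0 - r" x0 y0] True by simp
        moreover have "\<sigma> * (s0 - r) powr \<alpha> \<le> \<sigma> * s0 powr \<alpha>"
          using r \<sigma> \<alpha> \<delta>(1) True by (intro mult_left_mono powr_mono2) auto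
        \<comment> \<open>The indicator can be 1 here only at r = s0, where
          \<open>(s0 - r) powr \<alpha>\<close> is 0 and maximality gives the full amount.\<close>
        ultimately show ?thesis
          using True by (auto simp: indicator_def)
      next
        case False
        \<comment> \<open>Truncation at 0 does not increase the distance of the two times, so
          \<open>edge\<close> applies.\<close>
        then have "?W (0 - r) \<le> M - d / 2 + A * Q + E"
          using edge[of "max (t0 - r) 0" "max (s0 - r) 0"] r \<delta>(1) by (auto simp: max_def)
        moreover have "?W 0 = M + A * Q + E + \<sigma> * s0 powr \<alpha>"
          using pos by (simp add: M_def max_def)
        ultimately have "\<sigma> * s0 powr \<alpha> \<le> ?W 0 - ?W (0 - r)"
          using d by linarith
        moreover have "0 \<le> \<sigma> * s0 powr \<alpha>"
          using \<sigma>(1) by simp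
        ultimately show ?thesis
          by (auto simp: indicator_def)
      qed
      from divide_right_mono[OF this, of "r powr (1 + \<alpha>)"]
      show "?g r \<le> (?W 0 - ?W (0 - r)) / r powr (1 + \<alpha>)"
        by (simp add: mult_ac)
    qed
    also have "\<dots> = \<mu> * frac_tail \<alpha> \<delta> ?w1 t0 + frac_tail \<alpha> \<delta> ?w2 s0"
      by (rule frac_tail_combine[OF \<alpha>(1) \<delta>(1) c1 b1 c2 b2])
    finally show ?thesis .
  qed
  have h: "- \<kappa> \<le> \<mu> * H x0 ((A / \<mu>) *\<^sub>R ?p) - H y0 (A *\<^sub>R ?p)"
    using A(1) small AQ\<eta> by (intro H\<mu>) (auto simp: Q_def)
  have "\<mu> * frac_tail \<alpha> \<delta> ?w1 t0 + \<mu> * frac_near \<alpha> \<delta> ?f1 t0 + \<mu> * H x0 ((A / \<mu>) *\<^sub>R ?p) \<le> 0"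
    using mult_left_mono[OF 1 less_imp_le[OF \<mu>(1)]] by (simp only: distrib_left mult_zero_right)
  with 2 have "\<sigma> / \<alpha> \<le> \<sigma> / (4 * \<alpha>) + \<sigma> / (2 * \<alpha>)"
    using tails n1 n2 h K\<delta> \<kappa>(2) unfolding g by linarith
  then show False
    using \<sigma>(1) \<alpha> by (simp add: field_simps)
qed

section \<open>Regularity in space\<close>

text \<open>The substitution r = \<eta> q pulls out \<eta>^\<alpha> from both terms and reduces the
  claims to \<eta> = 1, where q^2 dominates C q^\<alpha> for q > 1 + C.\<close>

lemma scaled_concave_bound:
  fixes C \<eta> \<alpha> r :: real
  assumes "0 < \<alpha>" "\<alpha> < 1" "0 < C" "0 < \<eta>" "0 \<le> r"
  shows "C * r powr \<alpha> - \<eta> powr (\<alpha> - 2) * r\<^sup>2 \<le> (C + C\<^sup>2) * \<eta> powr \<alpha>"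
    and "\<eta> powr (\<alpha> - 2) * r\<^sup>2 \<le> C * r powr \<alpha> \<Longrightarrow> r \<le> (1 + C) * \<eta>"
proof -
  define q where "q = r / \<eta>"
  have q: "0 \<le> q" "r = \<eta> * q"
    using assms by (simp_all add: q_def)
  have p: "0 < \<eta> powr \<alpha>"
    using assms by simp
  have 1: "r powr \<alpha> = \<eta> powr \<alpha> * q powr \<alpha>"
    using q assms by (simp add: powr_mult)
  have 2: "\<eta> powr (\<alpha> - 2) * r\<^sup>2 = \<eta> powr \<alpha> * q\<^sup>2"
    using assms q by (simp add: powr_diff powr_numeral power_mult_distrib)
  have qle: "q powr \<alpha> \<le> q" if "1 \<le> q"
    using powr_mono[of \<alpha> 1 q] that assms by simp
  have "q powr \<alpha> \<le> 1 + q"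
  proof (cases "1 \<le> q")
    case True
    then show ?thesis
      using qle by simp
  next
    case False
    then have "q powr \<alpha> \<le> 1 powr \<alpha>"
      using q assms by (intro powr_mono2) auto
    then show ?thesis
      using q by simp
  qed
  then have "C * q powr \<alpha> \<le> C * (1 + q)"
    using assms by (intro mult_left_mono) auto
  moreover have "0 \<le> (q - C / 2)\<^sup>2" "0 \<le> C\<^sup>2"
    by simp_all
  moreover from this have "C * (1 + q) - q\<^sup>2 \<le> C + C\<^sup>2 / 4"
    by (simp add: power2_diff algebra_simps power_divide)
  ultimately have "C * q powr \<alpha> - q\<^sup>2 \<le> C + C\<^sup>2"
    by linarith
  from mult_left_mono[OF this less_imp_le[OF p]]
  show "C * r powr \<alpha> - \<eta> powr (\<alpha> - 2) * r\<^sup>2 \<le> (C + C\<^sup>2) * \<eta> powr \<alpha>"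
    unfolding 1 2 by (simp add: algebra_simps)
  assume "\<eta> powr (\<alpha> - 2) * r\<^sup>2 \<le> C * r powr \<alpha>"
  then have "\<eta> powr \<alpha> * q\<^sup>2 \<le> \<eta> powr \<alpha> * (C * q powr \<alpha>)"
    unfolding 1 2 by (simp add: mult_ac)
  then have le: "q\<^sup>2 \<le> C * q powr \<alpha>"
    using p by simp
  have "q \<le> 1 + C"
  proof (rule ccontr)
    assume "\<not> q \<le> 1 + C"
    then have big: "1 + C < q"
      by simp
    then have "q powr \<alpha> \<le> q"
      using qle assms by simp
    then have "C * q powr \<alpha> \<le> C * q"
      using assms by (intro mult_left_mono) auto
    with le have "q * q \<le> C * q"
      by (simp add: power2_eq_square)
    then show False
      using big assms by simp
  qed
  then show "r \<le> (1 + C) * \<eta>"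
    using q(2) assms by (simp add: mult.commute)
qed

text \<open>
  Penalising the time variable makes the nonlocal term at the maximum point finite up to the
  factor \<open>\<eta>\<^bsup>- \<theta>\<^esup>\<close>, where \<open>\<eta>\<close> is the time scale of the penalisation; coercivity then excludes a
  steep spatial slope.
\<close>

lemma space_estimate:
  fixes u :: "real ^ 'n \<Rightarrow> real \<Rightarrow> real"
  assumes \<alpha>: "0 < \<alpha>" "\<alpha> < 1"
    and sub: "sinsq_subsolution \<alpha> H u"
    and cont: "continuous_on (UNIV \<times> {0..}) (\<lambda>(x, t). u x t)"
    and per: "\<And>t. 0 \<le> t \<Longrightarrow> periodic (\<lambda>x. u x t)"
    and bound: "\<And>x t. 0 \<le> t \<Longrightarrow> \<bar>u x t\<bar> \<le> R"
    and L: "\<And>x y. u x 0 - u y 0 \<le> L * sqrt (sinsq (x - y))"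
    and C: "0 < C" "\<And>x t s. 0 \<le> t \<Longrightarrow> 0 \<le> s \<Longrightarrow> u x t - u x s \<le> C * \<bar>t - s\<bar> powr \<alpha>"
    and \<theta>: "0 < \<theta>" "\<theta> < \<alpha>" and \<eta>: "0 < \<eta>" "\<eta> \<le> 1"
    and K: "0 < K" "L \<le> K" "4 * R \<le> K"
    and HK: "\<And>x p. K \<le> norm p \<Longrightarrow>
      2 * ((2 * C + 3) / (1 - \<alpha>)) + (C + 2 * R) * (\<eta> powr - \<theta> / \<theta>) < H x p"
    and s0: "0 \<le> s0"
  shows "u x s0 - u y s0 \<le> K * sqrt (sinsq (x - y)) + (C + C\<^sup>2) * \<eta> powr \<alpha>"
proof (rule ccontr)
  assume contr: "\<not> ?thesis"
  have R: "0 \<le> R"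
    using bound[of 0 0] by simp
  \<comment> \<open>This exponent makes the penalty and the Hoelder bound C z^\<alpha> balance at
    time gaps z of order \<eta>, where both are of order \<eta>^\<alpha>.\<close>
  define P where "P = \<eta> powr (\<alpha> - 2)"
  have P: "0 < P"
    using \<eta> by (simp add: P_def)
  define V where "V = u y s0 + (C + C\<^sup>2) * \<eta> powr \<alpha>"
  define F where "F = (\<lambda>x t. u x t - K * sqrt (sinsq (x - y)) - P * (t - s0)\<^sup>2)"
  obtain x0 t0 where t0: "0 \<le> t0" and max: "\<And>x t. 0 \<le> t \<Longrightarrow> F x t \<le> F x0 t0"
  proof (rule periodic_attains_sup[of F "s0 + sqrt (2 * R / P)" y s0])
    have "continuous_on (UNIV \<times> {0..}) (\<lambda>z. (\<lambda>(x, t). u x t) z - K * sqrt (sinsq (fst z - y))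
        - P * (snd z - s0)\<^sup>2)"
      by (intro continuous_intros cont)
    then show "continuous_on (UNIV \<times> {0..}) (\<lambda>(x, t). F x t)"
      by (simp add: F_def case_prod_beta')
    show "periodic (\<lambda>x. F x t)" if "0 \<le> t" for t
      using per[OF that] sinsq_add_lattice[of _ "_ - y"] unfolding periodic_def F_def
      by (metis diff_add_eq)
    show "0 \<le> s0" "s0 \<le> s0 + sqrt (2 * R / P)"
      using s0 R P by auto
    fix x t assume t: "s0 + sqrt (2 * R / P) < t"
    then have "(sqrt (2 * R / P))\<^sup>2 \<le> (t - s0)\<^sup>2"
      using R P by (intro power_mono) auto
    then have "2 * R \<le> P * (t - s0)\<^sup>2"
      using R P by (simp add: field_simps)
    moreover have "0 \<le> sqrt (2 * R / P)"
      using R P by simp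
    then have "0 \<le> t"
      using t s0 by linarith
    moreover have "0 \<le> K * sqrt (sinsq (x - y))"
      using K by simp
    ultimately show "F x t \<le> F y s0"
      using bound[of t x] bound[OF s0, of y] by (simp add: F_def)
  qed blast
  have "V < F x s0"
    using contr by (simp add: F_def V_def)
  then have V: "V < F x0 t0"
    using max[OF s0, of x] by linarith
  have yt: "u y t - P * (t - s0)\<^sup>2 \<le> V" if "0 \<le> t" for t
    using scaled_concave_bound(1)[OF \<alpha> C(1) \<eta>(1), of "\<bar>t - s0\<bar>"] C(2)[OF that s0, of y]
    by (simp add: V_def P_def)
  have "sinsq (x0 - y) \<noteq> 0"
  proof
    assume "sinsq (x0 - y) = 0"
    then have "F x0 t0 = u y t0 - P * (t0 - s0)\<^sup>2"
      using periodic_eq_if_sinsq_0[OF per[OF t0]] by (simp add: F_def)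
    then show False
      using yt[OF t0] V by simp
  qed
  then have sq: "0 < sinsq (x0 - y)"
    using sinsq_nonneg[of "x0 - y"] by linarith
  define N where "N = sqrt (sinsq (x0 - y))"
  have N: "0 < N" "N\<^sup>2 = sinsq (x0 - y)"
    using sq by (simp_all add: N_def)
  have "t0 \<noteq> 0"
  proof
    assume "t0 = 0"
    moreover have "L * N \<le> K * N"
      using K(2) N(1) by (intro mult_right_mono) auto
    ultimately show False
      using L[of x0 y] yt[of 0] V by (simp add: F_def N_def)
  qed
  with t0 have pos: "0 < t0"
    by simp
  define z where "z = \<bar>t0 - s0\<bar>"
  have z: "z \<le> (1 + C) * \<eta>"
  proof (rule scaled_concave_bound(2)[OF \<alpha> C(1) \<eta>(1)])
    show "\<eta> powr (\<alpha> - 2) * z\<^sup>2 \<le> C * z powr \<alpha>"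
      using max[OF s0, of x0] C(2)[OF t0 s0, of x0] by (simp add: F_def P_def z_def)
  qed (simp add: z_def)
  \<comment> \<open>Comparison with x = y at the same time. With \<open>4 * R \<le> K\<close> it
    puts \<open>x0\<close> in the region where \<open>norm_sinsq_grad_ge\<close> turns the slope
    \<open>K\<close> into a lower bound for the gradient.\<close>
  have "K * N \<le> 2 * R"
    using max[OF t0, of y] bound[OF t0, of y] bound[OF t0, of x0] by (simp add: F_def N_def)
  also have "\<dots> \<le> K * (1 / 2)"
    using K(3) by simp
  finally have "N \<le> 1 / 2"
    using K(1) by simp
  then have "N\<^sup>2 \<le> (1 / 2)\<^sup>2"
    using N(1) by (intro power_mono) auto
  then have half: "sinsq (x0 - y) \<le> 1 / 2"
    using N(2) by (simp add: power2_eq_square)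
  define a where "a = K / (2 * N)"
  have a: "0 < a"
    using K N by (simp add: a_def)
  have tangent: "K * sqrt (sinsq (x - y)) \<le> K * N + a * (sinsq (x - y) - sinsq (x0 - y))" for x
  proof -
    have "sqrt (sinsq (x - y)) \<le> N + (sinsq (x - y) - sinsq (x0 - y)) / (2 * N)"
      using sqrt_tangent[OF sq, of "sinsq (x - y)"] by (simp add: N_def)
    from mult_left_mono[OF this less_imp_le[OF K(1)]] show ?thesis
      by (simp add: a_def distrib_left)
  qed
  define f where "f = (\<lambda>t. P * (t - s0)\<^sup>2)"
  \<comment> \<open>For lags r \<le> \<eta> the penalty drops by at most P r (2 z + r), where 2 z +
    r \<le> (2 C + 3) \<eta> and P \<eta> = \<eta>^(\<alpha>-1). Integrated over [0, \<eta>] this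
    costs (2 C + 3)/(1 - \<alpha>), whatever \<eta> is.\<close>
  define \<Lambda> where "\<Lambda> = (2 * C + 3) * \<eta> powr (\<alpha> - 1)"
  have \<Lambda>: "0 \<le> \<Lambda>" "\<Lambda> * (\<eta> powr (1 - \<alpha>) / (1 - \<alpha>)) = (2 * C + 3) / (1 - \<alpha>)"
    using C(1) \<eta>(1) by (simp_all add: \<Lambda>_def powr_add[symmetric])
  have inc: "- \<Lambda> * r \<le> f t0 - f (t0 - r)" if r: "0 \<le> r" "r \<le> \<eta>" for r
  proof -
    have "- (2 * z) \<le> 2 * (t0 - s0)"
      using abs_ge_minus_self[of "t0 - s0"] by (simp add: z_def)
    then have "- ((2 * C + 3) * \<eta>) \<le> 2 * (t0 - s0) - r"
      using z r by (simp add: algebra_simps)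
    then have "P * r * - ((2 * C + 3) * \<eta>) \<le> P * r * (2 * (t0 - s0) - r)"
      using P r by (intro mult_left_mono) auto
    also have "\<dots> = f t0 - f (t0 - r)"
      by (simp add: f_def power2_eq_square algebra_simps)
    finally have "P * r * - ((2 * C + 3) * \<eta>) \<le> f t0 - f (t0 - r)" .
    moreover have "P * \<eta> = \<eta> powr (\<alpha> - 1)"
      using \<eta>(1) powr_add[of \<eta> "\<alpha> - 2" 1] by (simp add: P_def)
    then have "P * r * - ((2 * C + 3) * \<eta>) = - \<Lambda> * r"
      by (simp add: \<Lambda>_def mult_ac)
    ultimately show ?thesis
      by linarith
  qed
  define \<delta> where "\<delta> = min \<eta> t0 / 2"
  have \<delta>: "0 < \<delta>" "\<delta> < t0" "\<delta> \<le> \<eta>"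
    using \<eta> pos by (auto simp: \<delta>_def)
  let ?w = "\<lambda>s. u x0 (max s 0)"
  have "frac_tail \<alpha> \<delta> ?w t0 + frac_near \<alpha> \<delta> f t0 + H x0 (a *\<^sub>R sinsq_grad (x0 - y)) \<le> 0"
  proof (rule sinsq_subsolutionD[OF sub \<delta>(1,2)])
    show "(f has_real_derivative P * (2 * (t - s0))) (at t)" for t
      unfolding f_def by (auto intro!: derivative_eq_intros)
    show "continuous_on {0<..} (\<lambda>t. P * (2 * (t - s0)))"
      by (intro continuous_intros)
    show "u x t - a * sinsq (x - y) - f t \<le> u x0 t0 - a * sinsq (x0 - y) - f t0" if "0 \<le> t" for x t
      using max[OF that, of x] tangent[of x]
      unfolding F_def f_def N_def[symmetric] right_diff_distrib by linarith
  qed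
  moreover have "- ((2 * C + 3) / (1 - \<alpha>)) \<le> frac_near \<alpha> \<delta> f t0"
  proof -
    have "\<Lambda> * (\<delta> powr (1 - \<alpha>) / (1 - \<alpha>)) \<le> \<Lambda> * (\<eta> powr (1 - \<alpha>) / (1 - \<alpha>))"
      using \<delta> \<alpha> \<Lambda>(1) by (intro mult_left_mono divide_right_mono powr_mono2) auto
    moreover have "- \<Lambda> * (\<delta> powr (1 - \<alpha>) / (1 - \<alpha>)) \<le> frac_near \<alpha> \<delta> f t0"
      using inc \<delta> \<alpha> \<Lambda>(1) by (intro frac_near_ge) auto
    ultimately show ?thesis
      using \<Lambda>(2) by linarith
  qed
  moreover have "- ((2 * C + 3) / (1 - \<alpha>)) - (C + 2 * R) * (\<eta> powr - \<theta> / \<theta>) \<le> frac_tail \<alpha> \<delta> ?w t0"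
  proof -
    \<comment> \<open>Up to lag \<eta>, maximality transfers the increment bound of the penalty to
      \<open>u\<close>. This minorant starts at lag 0 and repeats the cost of the near integral,
      hence the factor 2 in the hypothesis on \<open>H\<close>.\<close>
    let ?g1 = "\<lambda>r. - \<Lambda> * (indicator {0..\<eta>} r * r powr - \<alpha>)"
    let ?g2 = "\<lambda>r. - (C + 2 * R) * (indicator {\<eta>..} r * (1 / r powr (1 + \<theta>)))"
    note k1 = near_kernel[OF less_imp_le[OF \<eta>(1)] \<alpha>(2)] and k2 = tail_kernel[OF \<eta>(1) \<theta>(1)]
    have i1: "integrable lborel ?g1"
      using integrable.intros[OF k1] by (rule integrable_mult_right)
    have i2: "integrable lborel ?g2"
      using integrable.intros[OF k2] by (rule integrable_mult_right)
    have neg: "?g1 r \<le> 0" "?g2 r \<le> 0" for r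
      using \<Lambda>(1) C(1) R by (auto simp: indicator_def intro!: divide_nonpos_nonneg)
    have "integral\<^sup>L lborel ?g1 + integral\<^sup>L lborel ?g2
        = - \<Lambda> * (\<eta> powr (1 - \<alpha>) / (1 - \<alpha>)) + - (C + 2 * R) * (\<eta> powr - \<theta> / \<theta>)"
      by (simp only: integral_mult_right_zero has_bochner_integral_integral_eq[OF k1]
          has_bochner_integral_integral_eq[OF k2])
    then have "- ((2 * C + 3) / (1 - \<alpha>)) - (C + 2 * R) * (\<eta> powr - \<theta> / \<theta>)
        = (\<integral>r. ?g1 r + ?g2 r \<partial>lborel)"
      using \<Lambda>(2) Bochner_Integration.integral_add[OF i1 i2] by linarith
    also have "\<dots> \<le> frac_tail \<alpha> \<delta> ?w t0"
    proof (rule frac_tail_ge[OF \<alpha>(1) \<delta>(1)])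
      show "continuous_on UNIV ?w"
        by (rule continuous_on_at_point[OF cont])
      show "\<bar>?w s\<bar> \<le> R" for s
        by (rule bound) simp
      show "integrable lborel (\<lambda>r. ?g1 r + ?g2 r)"
        by (rule Bochner_Integration.integrable_add[OF i1 i2])
      show "?g1 r + ?g2 r \<le> 0" for r
        using neg[of r] by linarith
      fix r assume r: "\<delta> \<le> r"
      then have r0: "0 < r"
        using \<delta>(1) by simp
      define s where "s = max (t0 - r) 0"
      have s: "0 \<le> s" "s \<le> t0" "t0 - s \<le> r"
        using r0 pos by (auto simp: s_def)
      have w: "?w t0 - ?w (t0 - r) = u x0 t0 - u x0 s"
        using pos by (simp add: s_def max.absorb1)
      show "?g1 r + ?g2 r \<le> (?w t0 - ?w (t0 - r)) / r powr (1 + \<alpha>)"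
      proof (cases "r \<le> \<eta>")
        case True
        have "- \<Lambda> * r \<le> - \<Lambda> * (t0 - s)"
          using s \<Lambda>(1) by (simp add: mult_left_mono)
        also have "\<dots> \<le> f t0 - f s"
          using inc[of "t0 - s"] s True by simp
        also have "\<dots> \<le> ?w t0 - ?w (t0 - r)"
          unfolding w using max[OF s(1), of x0] by (simp add: F_def f_def)
        finally have "- \<Lambda> * r / r powr (1 + \<alpha>) \<le> (?w t0 - ?w (t0 - r)) / r powr (1 + \<alpha>)"
          by (intro divide_right_mono) auto
        moreover have "?g1 r = - \<Lambda> * r / r powr (1 + \<alpha>)"
          using True r0 by (simp add: powr_add powr_minus_divide)
        ultimately show ?thesis
          using neg(2)[of r] by linarith
      next
        case False
        \<comment> \<open>One power covers both regimes: r^\<alpha> \<le> r^(\<alpha>-\<theta>) for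
          r \<le> 1, and 1 \<le> r^(\<alpha>-\<theta>) beyond. Dividing by r^(1+\<alpha>) leaves
          r^(-1-\<theta>), integrable at infinity.\<close>
        have "- ((C + 2 * R) * r powr (\<alpha> - \<theta>)) \<le> ?w t0 - ?w (t0 - r)"
        proof (cases "r \<le> 1")
          case True
          have "u x0 s - u x0 t0 \<le> C * \<bar>s - t0\<bar> powr \<alpha>"
            by (rule C(2)[OF s(1) t0])
          also have "\<dots> \<le> C * r powr \<alpha>"
            using C(1) \<alpha> s by (intro mult_left_mono powr_mono2) auto
          also have "\<dots> \<le> (C + 2 * R) * r powr (\<alpha> - \<theta>)"
            using True r0 \<theta> C(1) R by (intro mult_mono powr_mono') auto
          finally show ?thesis
            unfolding w by simp
        next
          case r1: False
          have "u x0 s - u x0 t0 \<le> 2 * R"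
            using bound[OF s(1), of x0] bound[OF t0, of x0] by linarith
          also have "\<dots> \<le> (C + 2 * R) * r powr (\<alpha> - \<theta>)"
            using mult_mono[of "2 * R" "C + 2 * R" 1 "r powr (\<alpha> - \<theta>)"] r1 \<theta> C(1) R
            by (simp add: ge_one_powr_ge_zero)
          finally show ?thesis
            unfolding w by simp
        qed
        then have "- ((C + 2 * R) * r powr (\<alpha> - \<theta>)) / r powr (1 + \<alpha>)
            \<le> (?w t0 - ?w (t0 - r)) / r powr (1 + \<alpha>)"
          by (intro divide_right_mono) auto
        moreover have "?g2 r = - (C + 2 * R) * (r powr (\<alpha> - \<theta>) / r powr (1 + \<alpha>))"
          using False r0 by (simp add: powr_diff powr_add)
        then have "?g2 r = - ((C + 2 * R) * r powr (\<alpha> - \<theta>)) / r powr (1 + \<alpha>)"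
          by (simp only: times_divide_eq_right mult_minus_left)
        ultimately show ?thesis
          using neg(1)[of r] by linarith
      qed
    qed
    finally show ?thesis .
  qed
  moreover have "K \<le> norm (a *\<^sub>R sinsq_grad (x0 - y))"
  proof -
    have "a * (2 * N) \<le> a * norm (sinsq_grad (x0 - y))"
      using norm_sinsq_grad_ge[OF half] a by (simp add: N_def)
    then show ?thesis
      using K(1) N(1) by (simp add: a_def)
  qed
  ultimately show False
    using HK[of "a *\<^sub>R sinsq_grad (x0 - y)" x0] by linarith
qed

section \<open>The two estimates\<close>

text \<open>Here \<mu> = 1 suffices. For p = \<open>a *\<^sub>R sinsq_grad (x - y)\<close> the
  product of |p| and the distance is at most 2 pi a \<open>sinsq (x - y)\<close>, which is small
  even for large \<open>a\<close>.\<close>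

lemma doubling_cond_A:
  assumes "cond_A H"
  shows "doubling_cond H"
  unfolding doubling_cond_def
proof (intro allI impI)
  fix \<kappa> :: real assume \<kappa>: "0 < \<kappa>"
  obtain c where c: "0 < c" "\<And>x y p. \<bar>H x p - H y p\<bar> \<le> c * (1 + norm p) * torus_dist x y"
    using assms unfolding cond_A_def by blast
  define \<zeta> where "\<zeta> = \<kappa> / (c * (1 + 2 * pi))"
  have \<zeta>: "0 < \<zeta>" "c * ((1 + 2 * pi) * \<zeta>) = \<kappa>"
    using \<kappa> c pi_gt_zero by (auto simp: \<zeta>_def add_pos_pos field_simps add_nonneg_eq_0_iff)
  have "- \<kappa> \<le> 1 * H x ((a / 1) *\<^sub>R sinsq_grad (x - y)) - H y (a *\<^sub>R sinsq_grad (x - y))"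
    if h: "0 \<le> a" "sinsq (x - y) \<le> min \<zeta> (\<zeta>\<^sup>2)" "a * sinsq (x - y) \<le> min \<zeta> (\<zeta>\<^sup>2)" for x y a
  proof -
    let ?N = "sqrt (sinsq (x - y))" and ?p = "a *\<^sub>R sinsq_grad (x - y)"
    have "?N \<le> \<zeta>"
      using h(2) \<zeta>(1) by (intro real_le_lsqrt) auto
    have "norm ?p * torus_dist x y \<le> (a * (2 * pi * ?N)) * ?N"
      using norm_sinsq_grad_le[of "x - y"] torus_dist_le[of x y] torus_dist_nonneg[of x y] h(1)
      by (intro mult_mono) (auto intro!: mult_left_mono)
    also have "\<dots> = 2 * pi * (a * sinsq (x - y))"
      by simp
    also have "\<dots> \<le> 2 * pi * \<zeta>"
      using h(3) by (intro mult_left_mono) auto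
    finally have "(1 + norm ?p) * torus_dist x y \<le> (1 + 2 * pi) * \<zeta>"
      using torus_dist_le[of x y] \<open>?N \<le> \<zeta>\<close> by (simp add: distrib_right)
    from mult_left_mono[OF this less_imp_le[OF c(1)]]
    have "c * (1 + norm ?p) * torus_dist x y \<le> \<kappa>"
      using \<zeta>(2) by (simp add: mult.assoc)
    then show ?thesis
      using c(2)[of x ?p y] by simp
  qed
  moreover have "0 < min \<zeta> (\<zeta>\<^sup>2)"
    using \<zeta>(1) by simp
  ultimately show "\<exists>\<mu>>0. \<mu> \<le> 1 \<and> 1 - \<mu> \<le> \<kappa> \<and>
     (\<exists>\<eta>>0. \<forall>x y a. 0 \<le> a \<and> sinsq (x - y) \<le> \<eta> \<and> a * sinsq (x - y) \<le> \<eta> \<longrightarrow>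
        - \<kappa> \<le> \<mu> * H x ((a / \<mu>) *\<^sub>R sinsq_grad (x - y)) - H y (a *\<^sub>R sinsq_grad (x - y)))"
    using \<kappa> by (intro exI[of _ 1] conjI exI[of _ "min \<zeta> (\<zeta>\<^sup>2)"]) auto
qed

text \<open>With \<mu> = 1 - \<nu> the first inequality in (B) gains \<nu> |p|^m / c. It absorbs the
  error c |p|^m |x - y| once |x - y| \<le> \<nu>/c^2, uniformly in p; what remains is \<nu> A and c
  |x - y|, each at most half of \<kappa>.\<close>

lemma doubling_cond_B:
  assumes "cond_B H"
  shows "doubling_cond H"
  unfolding doubling_cond_def
proof (intro allI impI)
  fix \<kappa> :: real assume \<kappa>: "0 < \<kappa>"
  obtain m A c where c: "1 < m" "0 < A" "1 < c" and H: "\<forall>\<mu>\<in>{0<..<1}. \<forall>x y p.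
     \<mu> * H x (inverse \<mu> *\<^sub>R p) - H x p \<ge> (1 - \<mu>) * (inverse c * norm p powr m - A) \<and>
     \<bar>H x p - H y p\<bar> \<le> c * (1 + norm p powr m) * torus_dist x y"
    using assms unfolding cond_B_def by blast
  have H1: "\<And>\<mu> x p. 0 < \<mu> \<Longrightarrow> \<mu> < 1 \<Longrightarrow>
      (1 - \<mu>) * (inverse c * norm p powr m - A) \<le> \<mu> * H x (inverse \<mu> *\<^sub>R p) - H x p"
    and H2: "\<And>x y p.
      \<bar>H x p - H y p\<bar> \<le> c * (1 + norm p powr m) * torus_dist x y"
    using H bspec[OF H, of "1 / 2"] by auto
  define \<nu> where "\<nu> = min (1 / 2) (min \<kappa> (\<kappa> / (2 * A)))"
  have \<nu>: "0 < \<nu>" "\<nu> < 1" "\<nu> \<le> \<kappa>" "\<nu> * A \<le> \<kappa> / 2"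
  proof -
    show "0 < \<nu>" "\<nu> < 1" "\<nu> \<le> \<kappa>"
      using \<kappa> c by (auto simp: \<nu>_def)
    have "\<nu> * A \<le> (\<kappa> / (2 * A)) * A"
      using c by (intro mult_right_mono) (auto simp: \<nu>_def)
    then show "\<nu> * A \<le> \<kappa> / 2"
      using c by simp
  qed
  define \<zeta> where "\<zeta> = min (\<nu> / c\<^sup>2) (\<kappa> / (2 * c))"
  have \<zeta>: "0 < \<zeta>" "c * \<zeta> \<le> \<nu> * inverse c" "c * \<zeta> \<le> \<kappa> / 2"
  proof -
    show "0 < \<zeta>"
      using \<kappa> c \<nu> by (auto simp: \<zeta>_def)
    have "c * \<zeta> \<le> c * (\<nu> / c\<^sup>2)" "c * \<zeta> \<le> c * (\<kappa> / (2 * c))"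
      by (rule mult_left_mono; use c in \<open>simp add: \<zeta>_def\<close>)+
    then show "c * \<zeta> \<le> \<nu> * inverse c" "c * \<zeta> \<le> \<kappa> / 2"
      using c by (auto simp: power2_eq_square field_simps)
  qed
  have "- \<kappa> \<le> (1 - \<nu>) * H x ((a / (1 - \<nu>)) *\<^sub>R sinsq_grad (x - y)) - H y (a *\<^sub>R sinsq_grad (x - y))"
    if h: "sinsq (x - y) \<le> \<zeta>\<^sup>2" for x y a
  proof -
    define p where "p = a *\<^sub>R sinsq_grad (x - y)"
    have p: "(a / (1 - \<nu>)) *\<^sub>R sinsq_grad (x - y) = inverse (1 - \<nu>) *\<^sub>R p"
      by (simp add: p_def divide_inverse_commute)
    have "torus_dist x y \<le> \<zeta>"
      using torus_dist_le[of x y] real_le_lsqrt[OF less_imp_le[OF \<zeta>(1)] h] by linarith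
    then have cd: "c * torus_dist x y \<le> c * \<zeta>"
      using c by (intro mult_left_mono) auto
    have "c * torus_dist x y * norm p powr m \<le> \<nu> * inverse c * norm p powr m"
      using cd \<zeta>(2) by (intro mult_right_mono) auto
    moreover have "\<nu> * inverse c * norm p powr m - \<nu> * A
        \<le> (1 - \<nu>) * H x (inverse (1 - \<nu>) *\<^sub>R p) - H x p"
      using H1[of "1 - \<nu>" p x] \<nu> by (simp add: right_diff_distrib mult.assoc)
    moreover have "\<bar>H x p - H y p\<bar> \<le> c * torus_dist x y + c * torus_dist x y * norm p powr m"
      using H2[of x p y] by (simp add: algebra_simps)
    ultimately show ?thesis
      unfolding p p_def[symmetric] using cd \<zeta>(3) \<nu>(4) by linarith
  qed
  then show "\<exists>\<mu>>0. \<mu> \<le> 1 \<and> 1 - \<mu> \<le> \<kappa> \<and>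
     (\<exists>\<eta>>0. \<forall>x y a. 0 \<le> a \<and> sinsq (x - y) \<le> \<eta> \<and> a * sinsq (x - y) \<le> \<eta> \<longrightarrow>
        - \<kappa> \<le> \<mu> * H x ((a / \<mu>) *\<^sub>R sinsq_grad (x - y)) - H y (a *\<^sub>R sinsq_grad (x - y)))"
    using \<nu> \<zeta>(1) by (intro exI[of _ "1 - \<nu>"] conjI exI[of _ "\<zeta>\<^sup>2"]) auto
qed

section \<open>Bounds for the Hamiltonian and construction of a modulus\<close>

lemma periodic_bounded:
  fixes H :: "real ^ 'n \<Rightarrow> real ^ 'n \<Rightarrow> real"
  assumes "\<forall>p. periodic (\<lambda>x. H x p)" "continuous_on UNIV (\<lambda>(x, p). H x p)"
  obtains B where "0 < B" "\<And>x p. norm p \<le> r \<Longrightarrow> \<bar>H x p\<bar> < B"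
proof -
  let ?K = "cbox 0 (\<chi> i. 1) \<times> cball 0 r :: ((real ^ 'n) \<times> (real ^ 'n)) set"
  have "compact ((\<lambda>(x, p). H x p) ` ?K)"
    by (intro compact_continuous_image continuous_on_subset[OF assms(2)] compact_Times
        compact_cbox compact_cball) auto
  then obtain B where B: "0 < B" "\<forall>v\<in>(\<lambda>(x, p). H x p) ` ?K. norm v \<le> B"
    using compact_imp_bounded bounded_pos by blast
  have "\<bar>H x p\<bar> < B + 1" if "norm p \<le> r" for x p
  proof -
    obtain k where k: "k \<in> int_lattice" "x + k \<in> cbox 0 (\<chi> i. 1)"
      using ex_lattice_cbox by blast
    have "H (x + k) p \<in> (\<lambda>(x, p). H x p) ` ?K"
      using k(2) that by force
    then have "\<bar>H (x + k) p\<bar> \<le> B"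
      using B(2) by force
    moreover have "H (x + k) p = H x p"
      using periodicD[of "\<lambda>x. H x p"] assms(1) k(1) by blast
    ultimately show ?thesis
      by simp
  qed
  then show ?thesis
    using that[of "B + 1"] B(1) by simp
qed

text \<open>A real infimum bounds the values only if they are bounded below; periodicity and
  continuity provide this for each p.\<close>

lemma coerciveD:
  fixes H :: "real ^ 'n \<Rightarrow> real ^ 'n \<Rightarrow> real"
  assumes "\<forall>p. periodic (\<lambda>x. H x p)" "continuous_on UNIV (\<lambda>(x, p). H x p)" "coercive H"
  obtains K where "\<And>x p. K \<le> norm p \<Longrightarrow> Z < H x p"
proof -
  have "\<forall>\<^sub>F p in at_infinity. Z + 1 \<le> (INF x. H x p)"
    using assms(3) unfolding coercive_def filterlim_at_top by blast
  then obtain K where K: "\<And>p. K \<le> norm p \<Longrightarrow> Z + 1 \<le> (INF x. H x p)"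
    unfolding eventually_at_infinity by blast
  have "Z < H x p" if "K \<le> norm p" for x p
  proof -
    obtain B where B: "\<And>x q. norm q \<le> norm p \<Longrightarrow> \<bar>H x q\<bar> < B"
      using periodic_bounded[OF assms(1,2), where r = "norm p"] by metis
    have "- B \<le> H x p" for x
      using B[of p x] by simp
    then have "bdd_below (range (\<lambda>x. H x p))"
      by (intro bdd_belowI[of _ "- B"]) auto
    then have "(INF x. H x p) \<le> H x p"
      by (rule cINF_lower) simp
    then show ?thesis
      using K[OF that] by linarith
  qed
  then show ?thesis
    by (rule that)
qed

text \<open>An infimum of nondecreasing affine functions is subadditive, and hence continuous.\<close>

lemma modulus_from_affine_bounds:
  fixes S :: "(real \<times> real) set"
  assumes "\<And>e. 0 < e \<Longrightarrow> \<exists>K\<ge>0. \<forall>(v, r)\<in>S. v \<le> e + K * r"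
  obtains \<omega> where "modulus_of_continuity \<omega>" "\<And>v r. (v, r) \<in> S \<Longrightarrow> v \<le> \<omega> r"
proof -
  have "\<forall>n. \<exists>K\<ge>0. \<forall>(v, r)\<in>S. v \<le> 1 / real (Suc n) + K * r"
    using assms by simp
  then obtain K where K: "\<And>n. 0 \<le> K n" "\<And>n v r. (v, r) \<in> S \<Longrightarrow> v \<le> 1 / real (Suc n) + K n * r"
    by (metis case_prodD)
  define \<omega> where "\<omega> = (\<lambda>r. INF n. 1 / real (Suc n) + K n * r)"
  have bdd: "bdd_below (range (\<lambda>n. 1 / real (Suc n) + K n * r))" if "0 \<le> r" for r
    by (rule bdd_belowI[of _ 0]) (use K(1) that in auto)
  have le: "\<omega> r \<le> 1 / real (Suc n) + K n * r" if "0 \<le> r" for r n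
    unfolding \<omega>_def by (rule cINF_lower[OF bdd[OF that]]) simp
  have ge: "c \<le> \<omega> r" if "\<And>n. c \<le> 1 / real (Suc n) + K n * r" for c r
    unfolding \<omega>_def by (rule cINF_greatest) (use that in auto)
  have nonneg: "0 \<le> \<omega> r" if "0 \<le> r" for r
    using K(1) that by (intro ge) simp
  have mono: "\<omega> r \<le> \<omega> s" if "0 \<le> r" "r \<le> s" for r s
  proof (rule ge)
    fix n
    show "\<omega> r \<le> 1 / real (Suc n) + K n * s"
      using le[OF that(1), of n] mult_left_mono[OF that(2) K(1)[of n]] by linarith
  qed
  have subadd: "\<omega> (r + s) \<le> \<omega> r + \<omega> s" if rs: "0 \<le> r" "0 \<le> s" for r s
  proof -
    \<comment> \<open>The line with the smaller slope, taken at r + s, already lies below the sum of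
      the two values.\<close>
    have *: "\<omega> (r + s) \<le> (1 / real (Suc n) + K n * r) + (1 / real (Suc k) + K k * s)" for n k
    proof (cases "K n \<le> K k")
      case True
      have "\<omega> (r + s) \<le> 1 / real (Suc n) + K n * (r + s)"
        using le rs by simp
      also have "\<dots> \<le> 1 / real (Suc n) + K n * r + K k * s"
        using mult_right_mono[OF True rs(2)] by (simp add: distrib_left)
      also have "\<dots> \<le> (1 / real (Suc n) + K n * r) + (1 / real (Suc k) + K k * s)"
        by simp
      finally show ?thesis .
    next
      case False
      have "\<omega> (r + s) \<le> 1 / real (Suc k) + K k * (r + s)"
        using le rs by simp
      also have "\<dots> \<le> 1 / real (Suc k) + K n * r + K k * s"
        using mult_right_mono[of "K k" "K n" r] False rs(1) by (simp add: distrib_left)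
      also have "\<dots> \<le> (1 / real (Suc n) + K n * r) + (1 / real (Suc k) + K k * s)"
        by simp
      finally show ?thesis .
    qed
    have "\<omega> (r + s) - (1 / real (Suc k) + K k * s) \<le> \<omega> r" for k
      using *[of _ k] by (intro ge) (simp add: algebra_simps)
    then have "\<omega> (r + s) - \<omega> r \<le> \<omega> s"
      by (intro ge) (simp add: algebra_simps)
    then show ?thesis
      by simp
  qed
  have small: "\<exists>d>0. \<forall>r. 0 \<le> r \<and> r < d \<longrightarrow> \<omega> r < e" if e: "0 < e" for e
  proof -
    obtain n where n: "1 / real (Suc n) < e / 2"
      using nat_approx_posE[of "e / 2"] e by auto
    have "\<omega> r < e" if "0 \<le> r" "r < e / (2 * (K n + 1))" for r
    proof -
      have "(K n + 1) * r \<le> e / 2"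
        using that K(1)[of n] by (simp add: field_simps)
      then have "K n * r \<le> e / 2"
        using that by (simp add: distrib_right)
      then show ?thesis
        using le[OF that(1), of n] n by linarith
    qed
    moreover have "0 < e / (2 * (K n + 1))"
      using e K(1)[of n] by simp
    ultimately show ?thesis
      by blast
  qed
  have diff: "\<bar>\<omega> r - \<omega> s\<bar> \<le> \<omega> \<bar>r - s\<bar>" if "0 \<le> r" "0 \<le> s" for r s
  proof (cases "r \<le> s")
    case True
    then show ?thesis
      using subadd[of r "s - r"] mono[of r s] that by simp
  next
    case False
    then show ?thesis
      using subadd[of s "r - s"] mono[of s r] that by simp
  qed
  have "continuous_on {0..} \<omega>"
    unfolding continuous_on_iff
  proof (intro ballI allI impI)
    fix r e :: real assume r: "r \<in> {0..}" and "0 < e"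
    then obtain d where d: "0 < d" "\<And>r. 0 \<le> r \<Longrightarrow> r < d \<Longrightarrow> \<omega> r < e"
      using small by blast
    have "dist (\<omega> s) (\<omega> r) < e" if "s \<in> {0..}" "dist s r < d" for s
      using diff[of s r] d(2)[of "\<bar>s - r\<bar>"] that r by (simp add: dist_real_def)
    with d(1) show "\<exists>d>0. \<forall>s\<in>{0..}. dist s r < d \<longrightarrow> dist (\<omega> s) (\<omega> r) < e"
      by blast
  qed
  moreover have "\<omega> 0 = 0"
  proof (rule antisym)
    have "\<omega> 0 \<le> 0 + e" if e: "0 < e" for e
    proof -
      obtain d where "0 < d" "\<forall>r. 0 \<le> r \<and> r < d \<longrightarrow> \<omega> r < e"
        using small[OF e] by blast
      then show ?thesis
        by (simp add: less_imp_le)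
    qed
    then show "\<omega> 0 \<le> 0"
      by (rule field_le_epsilon)
  qed (simp add: nonneg)
  ultimately have "modulus_of_continuity \<omega>"
    using nonneg mono unfolding modulus_of_continuity_def mono_on_def by auto
  moreover have "v \<le> \<omega> r" if "(v, r) \<in> S" for v r
    using K(2)[OF that] by (intro ge) auto
  ultimately show ?thesis
    by (rule that)
qed

lemma abs_le_sup_norm:
  assumes "bounded ((\<lambda>(x, t). u x t) ` (UNIV \<times> {0..}))" "0 \<le> t"
  shows "\<bar>u x t\<bar> \<le> sup_norm u"
proof -
  obtain B where B: "\<And>x t. 0 \<le> t \<Longrightarrow> \<bar>u x t\<bar> \<le> B"
    using assms(1) unfolding bounded_iff by (force simp: image_iff)
  have "bdd_above ((\<lambda>(x, t). \<bar>u x t\<bar>) ` (UNIV \<times> {0..}))"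
    by (rule bdd_aboveI[of _ B]) (use B in auto)
  from cSUP_upper[OF _ this, of "(x, t)"] assms(2) show ?thesis
    by (simp add: sup_norm_def)
qed

text \<open>No constant refers to \<open>u\<close> except through \<open>R\<close>, which makes the
  final bounds common to all solutions with the same norm. The ball of radius \<open>pi * L\<close>
  is symmetric, so \<open>B\<close> serves both \<open>u\<close> and -u in
  \<open>initial_growth\<close>.\<close>

lemma solution_space_estimate:
  fixes u :: "real ^ 'n \<Rightarrow> real \<Rightarrow> real"
  assumes \<alpha>: "0 < \<alpha>" "\<alpha> < 1"
    and dc: "doubling_cond H"
    and g: "0 \<le> L" "\<And>x y. \<bar>g x - g y\<bar> \<le> L * torus_dist x y"
    and B: "0 < B" "\<And>x p. norm p \<le> pi * L \<Longrightarrow> \<bar>H x p\<bar> < B"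
    and C: "C = \<alpha> * B"
    and sol: "bounded_visc_solution \<alpha> H g u" "sup_norm u = R"
    and \<theta>: "0 < \<theta>" "\<theta> < \<alpha>" and \<eta>: "0 < \<eta>" "\<eta> \<le> 1"
    and K: "0 < K" "L \<le> K" "4 * R \<le> K"
    and HK: "\<And>x p. K \<le> norm p \<Longrightarrow>
      2 * ((2 * C + 3) / (1 - \<alpha>)) + (C + 2 * R) * (\<eta> powr - \<theta> / \<theta>) < H x p"
    and t: "0 \<le> t"
  shows "\<bar>u x t - u y t\<bar> \<le> K * sqrt (sinsq (x - y)) + (C + C\<^sup>2) * \<eta> powr \<alpha>"
proof -
  have per: "periodic (\<lambda>x. u x t)" if "0 \<le> t" for t
    using sol that by (simp add: bounded_visc_solution_def)
  have cont: "continuous_on (UNIV \<times> {0..}) (\<lambda>(x, t). u x t)"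
    using sol by (simp add: bounded_visc_solution_def)
  have sub: "sinsq_subsolution \<alpha> H u"
    using sol by (intro visc_subsolution_imp) (simp add: bounded_visc_solution_def)
  have sup: "sinsq_subsolution \<alpha> (\<lambda>x p. - H x (- p)) (\<lambda>x t. - u x t)"
    using sol by (intro visc_supersolution_imp) (simp add: bounded_visc_solution_def)
  have bound: "\<bar>u x t\<bar> \<le> R" if "0 \<le> t" for x t
    using abs_le_sup_norm[of u t x] sol that by (simp add: bounded_visc_solution_def)
  have init: "\<bar>u x 0 - u y 0\<bar> \<le> L * sqrt (sinsq (x - y))" for x y
    using g(2)[of x y] mult_left_mono[OF torus_dist_le g(1), of x y] sol
    by (simp add: bounded_visc_solution_def)
  have C0: "0 < C"
    using \<alpha> B by (simp add: C)
  have up: "u x t \<le> u x 0 + C * t powr \<alpha>" if "0 \<le> t" for x t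
    unfolding C
  proof (rule initial_growth[OF \<alpha> sub cont per bound g(1) _ B(1) _ that])
    show "u x 0 - u y 0 \<le> L * sqrt (sinsq (x - y))" for x y
      using init[of x y] by linarith
    show "- B < H x p" if "norm p \<le> pi * L" for x p
      using B(2)[OF that, of x] by linarith
  qed
  have cont': "continuous_on (UNIV \<times> {0..}) (\<lambda>(x, t). - u x t)"
    using continuous_on_minus[OF cont] by (simp add: case_prod_beta')
  have per': "periodic (\<lambda>x. - u x t)" if "0 \<le> t" for t
    using per[OF that] by (simp add: periodic_def)
  have down: "- u x t \<le> - u x 0 + C * t powr \<alpha>" if "0 \<le> t" for x t
    unfolding C
  proof (rule initial_growth[OF \<alpha> sup cont' per' _ g(1) _ B(1) _ that])
    show "- u x 0 - - u y 0 \<le> L * sqrt (sinsq (x - y))" for x y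
      using init[of x y] by linarith
    show "- B < - H x (- p)" if "norm p \<le> pi * L" for x p
      using B(2)[of "- p" x] that by (simp add: abs_less_iff)
    show "\<bar>- u x t\<bar> \<le> R" if "0 \<le> t" for x t
      using bound[OF that] by simp
  qed
  have near0: "\<bar>u x t - u x 0\<bar> \<le> C * t powr \<alpha>" if "0 \<le> t" for x t
    using up[OF that, of x] down[OF that, of x] by (simp add: abs_le_iff)
  have init': "u x 0 - u y 0 \<le> L * sqrt (sinsq (x - y))" for x y
    using init[of x y] by linarith
  have time: "u x t - u x s \<le> C * \<bar>t - s\<bar> powr \<alpha>" if "0 \<le> t" "0 \<le> s" for x t s
    by (rule time_holder[OF \<alpha> sub sup cont per bound g(1) init' C0 near0 dc that])
  have "u x t - u y t \<le> K * sqrt (sinsq (x - y)) + (C + C\<^sup>2) * \<eta> powr \<alpha>" for x y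
    by (rule space_estimate[OF \<alpha> sub cont per bound init' C0 time \<theta> \<eta> K HK t])
  from this[of x y] this[of y x] show ?thesis
    by (simp add: sinsq_commute[of y x] abs_le_iff)
qed

theorem theorem2p2:
  fixes \<alpha> :: real
    and H :: "real ^ 'n \<Rightarrow> real ^ 'n \<Rightarrow> real"
    and g :: "real ^ 'n \<Rightarrow> real"
  assumes alpha: "0 < \<alpha>" "\<alpha> < 1"
    and H_periodic: "\<forall>p. periodic (\<lambda>x. H x p)"
    and H_continuous: "continuous_on UNIV (\<lambda>(x, p). H x p)"
    and H_coercive: "coercive H"
    and g_periodic: "periodic g"
    and g_Lipschitz: "\<exists>L. \<forall>x y. \<bar>g x - g y\<bar> \<le> L * torus_dist x y"
    and H_cond: "cond_A H \<or> cond_B H"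
  shows
    "(\<forall>R. \<exists>\<omega>. modulus_of_continuity \<omega> \<and>
        (\<forall>u. bounded_visc_solution \<alpha> H g u \<and> sup_norm u = R \<longrightarrow>
           (\<forall>x y. \<forall>t\<ge>0. \<bar>u x t - u y t\<bar> \<le> \<omega> (torus_dist x y)))) \<and>
     ((\<exists>m\<ge>1. \<exists>C0>0. \<forall>x p. H x p \<ge> inverse C0 * norm p powr m - C0) \<longrightarrow>
        (\<forall>\<beta>\<in>{0<..<1}. \<forall>R. \<exists>C>0.
           \<forall>u. bounded_visc_solution \<alpha> H g u \<and> sup_norm u = R \<longrightarrow>
             (\<forall>x y. \<forall>t\<ge>0. \<bar>u x t - u y t\<bar> \<le> C * torus_dist x y powr \<beta>)))"
proof -
  have dc: "doubling_cond H"
    using H_cond doubling_cond_A doubling_cond_B by blast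
  obtain L where L: "0 \<le> L" "\<And>x y. \<bar>g x - g y\<bar> \<le> L * torus_dist x y"
  proof -
    obtain L where L: "\<And>x y. \<bar>g x - g y\<bar> \<le> L * torus_dist x y"
      using g_Lipschitz by blast
    have "L * torus_dist x y \<le> \<bar>L\<bar> * torus_dist x y" for x y
      using torus_dist_nonneg[of x y] by (intro mult_right_mono) auto
    then show ?thesis
      using that[of "\<bar>L\<bar>"] L by (meson abs_ge_zero order_trans)
  qed
  obtain B where B: "0 < B" "\<And>x p. norm p \<le> pi * L \<Longrightarrow> \<bar>H x p\<bar> < B"
    using periodic_bounded[OF H_periodic H_continuous] by blast
  define C where "C = \<alpha> * B"
  define D where "D = C + C\<^sup>2"
  have C: "0 < C" "0 < D"
    using alpha B by (simp_all add: C_def D_def add_pos_pos)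
  note estimate = solution_space_estimate[OF alpha dc L B C_def, folded D_def]
  have part1: "\<exists>\<omega>. modulus_of_continuity \<omega> \<and>
        (\<forall>u. bounded_visc_solution \<alpha> H g u \<and> sup_norm u = R \<longrightarrow>
           (\<forall>x y. \<forall>t\<ge>0. \<bar>u x t - u y t\<bar> \<le> \<omega> (torus_dist x y)))" for R
  proof -
    \<comment> \<open>The pairs are collected over all solutions with norm \<open>R\<close>, so a
      single modulus serves them all.\<close>
    define S where "S = {(\<bar>u x t - u y t\<bar>, torus_dist x y) | u x y t.
      bounded_visc_solution \<alpha> H g u \<and> sup_norm u = R \<and> 0 \<le> t}"
    have "\<exists>K\<ge>0. \<forall>(v, r)\<in>S. v \<le> e + K * r" if e: "0 < e" for e
    proof -
      \<comment> \<open>The largest admissible scale with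
        \<open>D * \<eta> powr \<alpha> \<le> e\<close>. Any fixed \<theta> < \<alpha> would do
        below; \<alpha>/2 is taken.\<close>
      define \<eta> where "\<eta> = min 1 ((e / D) powr (1 / \<alpha>))"
      have \<eta>: "0 < \<eta>" "\<eta> \<le> 1"
        using e C by (auto simp: \<eta>_def)
      have "\<eta> powr \<alpha> \<le> ((e / D) powr (1 / \<alpha>)) powr \<alpha>"
        using \<eta> alpha by (intro powr_mono2) (auto simp: \<eta>_def)
      also have "\<dots> = e / D"
        using alpha e C by (intro powr_power_inverse) auto
      finally have D\<eta>: "D * \<eta> powr \<alpha> \<le> e"
        using C by (simp add: field_simps)
      obtain K0 where K0: "\<And>x p. K0 \<le> norm p \<Longrightarrow>
          2 * ((2 * C + 3) / (1 - \<alpha>)) + (C + 2 * R) * (\<eta> powr - (\<alpha> / 2) / (\<alpha> / 2)) < H x p"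
        using coerciveD[OF H_periodic H_continuous H_coercive] by blast
      define K where "K = max (max 1 K0) (max L (4 * R))"
      have K: "0 < K" "L \<le> K" "4 * R \<le> K" "K0 \<le> K"
        by (auto simp: K_def)
      have "v \<le> e + (K * pi) * r" if vr: "(v, r) \<in> S" for v r
      proof -
        obtain u x y t where u: "bounded_visc_solution \<alpha> H g u" "sup_norm u = R" "0 \<le> t"
          and vr: "v = \<bar>u x t - u y t\<bar>" "r = torus_dist x y"
          using vr unfolding S_def by blast
        have "v \<le> K * sqrt (sinsq (x - y)) + D * \<eta> powr \<alpha>"
          unfolding vr(1)
        proof (rule estimate[OF _ u(1,2) _ _ \<eta> K(1-3) _ u(3)])
          show "0 < \<alpha> / 2" "\<alpha> / 2 < \<alpha>"
            using alpha by auto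
        qed (use K0 K(4) in auto)
        also have "K * sqrt (sinsq (x - y)) \<le> K * (pi * r)"
          unfolding vr(2) using K(1) by (intro mult_left_mono sqrt_sinsq_le) auto
        finally show ?thesis
          using D\<eta> by (simp add: mult.assoc)
      qed
      moreover have "0 \<le> K * pi"
        using K(1) by simp
      ultimately show ?thesis
        by blast
    qed
    then obtain \<omega> where \<omega>: "modulus_of_continuity \<omega>" "\<And>v r. (v, r) \<in> S \<Longrightarrow> v \<le> \<omega> r"
      using modulus_from_affine_bounds[of S] by metis
    have "\<bar>u x t - u y t\<bar> \<le> \<omega> (torus_dist x y)"
      if "bounded_visc_solution \<alpha> H g u" "sup_norm u = R" "0 \<le> t" for u x y t
      using that by (intro \<omega>(2)) (auto simp: S_def)
    with \<omega>(1) show ?thesis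
      by blast
  qed
  have part2: "\<exists>C>0. \<forall>u. bounded_visc_solution \<alpha> H g u \<and> sup_norm u = R \<longrightarrow>
             (\<forall>x y. \<forall>t\<ge>0. \<bar>u x t - u y t\<bar> \<le> C * torus_dist x y powr \<beta>)"
    if m: "1 \<le> m" and C0: "0 < C0" and growth: "\<And>x p. inverse C0 * norm p powr m - C0 \<le> H x p"
      and \<beta>: "0 < \<beta>" "\<beta> < 1" for m C0 \<beta> R
  proof -
    define \<theta> where "\<theta> = \<alpha> * (1 - \<beta>)"
    have \<theta>: "0 < \<theta>" "\<theta> < \<alpha>"
      using alpha \<beta> by (simp_all add: \<theta>_def)
    \<comment> \<open>Since E = \<eta>^(-\<theta>) \<ge> 1, the level that \<open>H\<close> has to
      exceed in the estimate is at most \<open>B1 * E\<close>. The absolute value keeps the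
      constants positive for every real \<open>R\<close>.\<close>
    define B1 where "B1 = 2 * ((2 * C + 3) / (1 - \<alpha>)) + (C + 2 * \<bar>R\<bar>) / \<theta>"
    have B1: "0 \<le> B1"
      using C alpha \<theta> by (simp add: B1_def)
    \<comment> \<open>The last summand inverts the growth condition: |p|^m \<ge> (1 + C0 (B1 + C0))
      E gives \<open>H\<close> at least E/C0 + B1 E + C0 E - C0 > B1 E.\<close>
    define K1 where "K1 = 1 + L + 4 * \<bar>R\<bar> + C0 * (B1 + C0)"
    have K1: "1 \<le> K1" "L \<le> K1" "4 * R \<le> K1" "1 + C0 * (B1 + C0) \<le> K1"
      using L(1) C0 mult_nonneg_nonneg[of C0 "B1 + C0"] B1 unfolding K1_def by linarith+
    define C' where "C' = (K1 + D + 2 * \<bar>R\<bar>) * pi"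
    have pos: "0 \<le> K1 + D + 2 * \<bar>R\<bar>" "0 < C'"
      using K1(1) C by (simp_all add: C'_def)
    have est: "\<bar>u x t - u y t\<bar> \<le> C' * torus_dist x y powr \<beta>"
      if u: "bounded_visc_solution \<alpha> H g u" "sup_norm u = R" and t: "0 \<le> t" for u x y t
    proof (cases "sinsq (x - y) = 0")
      case True
      have "periodic (\<lambda>x. u x t)"
        using u t by (simp add: bounded_visc_solution_def)
      then have "u x t = u y t"
        using True by (rule periodic_eq_if_sinsq_0)
      then show ?thesis
        using pos by simp
    next
      case False
      define N where "N = sqrt (sinsq (x - y))"
      have N: "0 < N"
        using False by (simp add: N_def order_less_le)
      have "\<bar>u x t - u y t\<bar> \<le> (K1 + D + 2 * \<bar>R\<bar>) * N powr \<beta>"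
      proof (cases "N \<le> 1")
        case True
        \<comment> \<open>Then the time error is \<open>D * N\<close>, and the slope K1
          \<eta>^(-\<theta>) contributes K1 N^\<beta>.\<close>
        define \<eta> where "\<eta> = N powr (1 / \<alpha>)"
        have \<eta>: "0 < \<eta>" "\<eta> \<le> 1"
          using N True alpha by (auto simp: \<eta>_def powr_le1)
        have \<eta>\<alpha>: "\<eta> powr \<alpha> = N"
          unfolding \<eta>_def using alpha N by (intro powr_power_inverse) auto
        have "\<eta> powr - \<theta> * N = N powr (- (1 - \<beta>)) * N powr 1"
          using alpha N by (simp add: \<eta>_def \<theta>_def powr_powr)
        also have "\<dots> = N powr \<beta>"
          unfolding powr_add[symmetric] by simp
        finally have \<eta>N: "\<eta> powr - \<theta> * N = N powr \<beta>" .
        define E where "E = \<eta> powr - \<theta>"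
        have E: "1 \<le> E"
          using \<eta> \<theta> powr_mono2'[of "- \<theta>" \<eta> 1] by (simp add: E_def)
        define K where "K = K1 * E"
        have "K1 * 1 \<le> K"
          unfolding K_def using K1 E by (intro mult_left_mono) auto
        then have K: "K1 \<le> K"
          by simp
        have "\<bar>u x t - u y t\<bar> \<le> K * sqrt (sinsq (x - y)) + D * \<eta> powr \<alpha>"
        proof (rule estimate[OF _ u \<theta> \<eta> _ _ _ _ t])
          show "0 < K" "L \<le> K" "4 * R \<le> K"
            using K K1 by linarith+
          fix x p assume p: "K \<le> norm (p :: real ^ 'n)"
          have "1 \<le> norm p"
            using p K K1 by linarith
          \<comment> \<open>For |p| \<ge> 1 growth of order m is at least linear, so a slope linear
            in E suffices.\<close>
          then have "norm p \<le> norm p powr m"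
            using powr_mono[of 1 m "norm p"] m by simp
          with p have "K \<le> norm p powr m"
            by linarith
          have "(1 + C0 * (B1 + C0)) * E \<le> K"
            unfolding K_def using K1(4) E by (intro mult_right_mono) auto
          with \<open>K \<le> norm p powr m\<close> have "(1 + C0 * (B1 + C0)) * E \<le> norm p powr m"
            by linarith
          from mult_left_mono[OF this, of "inverse C0"]
          have "E / C0 + B1 * E + C0 * E \<le> inverse C0 * norm p powr m"
            using C0 by (simp add: field_simps)
          moreover have "0 < E / C0" "C0 * 1 \<le> C0 * E"
            using E C0 by (auto intro!: mult_left_mono)
          ultimately have "B1 * E < H x p"
            using growth[of p x] by linarith
          moreover have "2 * ((2 * C + 3) / (1 - \<alpha>)) * 1 \<le> 2 * ((2 * C + 3) / (1 - \<alpha>)) * E"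
            using C alpha E by (intro mult_left_mono) auto
          moreover have "(C + 2 * R) * (E / \<theta>) \<le> (C + 2 * \<bar>R\<bar>) * (E / \<theta>)"
            using \<theta> E by (intro mult_right_mono) auto
          ultimately show "2 * ((2 * C + 3) / (1 - \<alpha>)) + (C + 2 * R) * (\<eta> powr - \<theta> / \<theta>) < H x p"
            unfolding E_def[symmetric] B1_def by (simp add: distrib_right)
        qed simp
        also have "\<dots> = K1 * N powr \<beta> + D * N"
          using \<eta>N by (simp add: K_def E_def N_def[symmetric] \<eta>\<alpha> mult.assoc)
        also have "\<dots> \<le> K1 * N powr \<beta> + D * N powr \<beta>"
          using powr_mono'[of \<beta> 1 N] \<beta> N True C by simp
        also have "\<dots> \<le> (K1 + D + 2 * \<bar>R\<bar>) * N powr \<beta>"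
          by (simp add: distrib_right)
        finally show ?thesis .
      next
        case False
        \<comment> \<open>At distances N > 1 the bound on \<open>u\<close> is enough, as N^\<beta>
          \<ge> 1.\<close>
        have "\<bar>u x t\<bar> \<le> R" for x
          using abs_le_sup_norm[of u t x] u t by (simp add: bounded_visc_solution_def)
        from this[of x] this[of y] have "\<bar>u x t - u y t\<bar> \<le> 2 * \<bar>R\<bar> * 1"
          by linarith
        also have "\<dots> \<le> (K1 + D + 2 * \<bar>R\<bar>) * N powr \<beta>"
          using K1(1) C False \<beta> by (intro mult_mono) (auto simp: ge_one_powr_ge_zero)
        finally show ?thesis .
      qed
      also have "\<dots> \<le> (K1 + D + 2 * \<bar>R\<bar>) * (pi * torus_dist x y powr \<beta>)"
      proof (rule mult_left_mono[OF _ pos(1)])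
        have "N powr \<beta> \<le> (pi * torus_dist x y) powr \<beta>"
          using N \<beta> sqrt_sinsq_le[of x y] by (intro powr_mono2) (auto simp: N_def)
        also have "\<dots> = pi powr \<beta> * torus_dist x y powr \<beta>"
          using torus_dist_nonneg[of x y] by (simp add: powr_mult)
        also have "\<dots> \<le> pi powr 1 * torus_dist x y powr \<beta>"
          using pi_ge_two \<beta> by (intro mult_right_mono powr_mono) auto
        finally show "N powr \<beta> \<le> pi * torus_dist x y powr \<beta>"
          by simp
      qed
      finally show ?thesis
        by (simp add: C'_def mult.assoc)
    qed
    with pos(2) show ?thesis
      by blast
  qed
  show ?thesis
    using part1 part2 by (meson greaterThanLessThan_iff)
qed

end
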